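(* Let $\mathcal G=(V,E)$ be a series-parallel graph and let $e,f$ be distinct edges of $\mathcal G$. Let $G$ be the spanning forest generating polynomial of $\mathcal G$. Then there is a choice of signs $c(S,C)\in\{+1,-1\}$, depending only on an S-set $S$ and a cycle $C$, such that $$\Delta G\{e,f\}=\sum_{S\in\mathscr S}\mathbf y^S\Big(\sum_{A\in\mathscr A(S)} c(S,C_A)\,\mathbf y^{A\setminus S}\Big)^2,$$ where $C_A$ denotes the cycle associated to $A$ (see context). In other words, every series-parallel graph is SOS.
   Context: Graphs may have parallel edges. For a graph $\mathcal G=(V,E)$ with indeterminates $\mathbf y=(y_g:g\in E)$, the spanning forest polynomial is $G=\sum_{X}\mathbf y^X$, the sum over all acyclic edge sets $X\subseteq E$ (spanning forests), where $\mathbf y^X=\prod_{x\in X}y_x$. Write $G_e=\partial G/\partial y_e$, $G_{ef}=\partial^2G/\partial y_e\partial y_f$, and $\Delta G\{e,f\}=G_eG_f-GG_{ef}$. S-sets and A-sets (for fixed distinct edges $e,f$): $\mathscr S$ is the collection of sets $S\subseteq E\setminus\{e,f\}$ such that $S\cup\{e,f\}$ is contained in some cycle of $\mathcal G$. For $S\in\mathscr S$, $\mathscr A(S)$ is the collection of spanning forests $A\subseteq E\setminus\{e,f\}$ for which there is a unique cycle $C$ of $\mathcal G$ with $S\cup\{e,f\}\subseteq C\subseteq A\cup\{e,f\}$; this cycle is denoted $C_A$. A graph is SOS if the displayed identity holds (for some signs $c(S,C)$) for every pair of distinct edges $e,f$. Two-sum: if graphs $\mathcal H$ and $\mathcal K$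 have exactly one edge $g$ in common, $\mathcal H\oplus_g\mathcal K$ is obtained by identifying the copy of $g$ in $\mathcal H$ with the copy in $\mathcal K$ (endpoints identified in either of the two possible ways) and then deleting $g$; its edge set is $(E(\mathcal H)\cup E(\mathcal K))\setminus\{g\}$. Let $K_3$ be the triangle and $(K_3)^*$ the graph of three mutually parallel edges on two vertices. A series extension of $\mathcal G$ is $\mathcal G\oplus_g K_3$ and a parallel extension is $\mathcal G\oplus_g (K_3)^*$ for an edge $g$ of $\mathcal G$. A graph is series-parallel if it is a minor of a graph obtained from $K_3$ or $(K_3)^*$ by a finite sequence of series and parallel extensions.
   Formalization: In the definition of 𝒜(S), the cycle C_A is required to be the only cycle contained in A∪{e,f}, not merely the only one containing S∪{e,f}; with the latter reading the identity fails for K₄ minus an edge. *)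

theory Defs
  imports "HOL-Library.Poly_Mapping"
begin

section \<open>Finite graphs with parallel edges\<close>

text \<open>
  Contraction in a graph with parallel edges produces loops, so loops are allowed: an edge \<open>x\<close> is
  a loop iff \<open>ends G x\<close> is a singleton. The value of \<open>ends G\<close> outside \<open>edges G\<close> is irrelevant.
\<close>

record ('v, 'e) mgraph =
  verts :: "'v set"
  edges :: "'e set"
  ends :: "'e \<Rightarrow> 'v set"

definition wf_mgraph :: "('v, 'e) mgraph \<Rightarrow> bool" where
  "wf_mgraph G \<longleftrightarrow> finite (verts G) \<and> finite (edges G) \<and>
     (\<forall>x\<in>edges G. ends G x \<subseteq> verts G \<and> (card (ends G x) = 1 \<or> card (ends G x) = 2))"

text \<open>
  Cycles are identified with their edge sets. A loop is a cycle of length 1, and two parallel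
  (non-loop) edges form a cycle of length 2.
\<close>

definition is_cycle :: "('v, 'e) mgraph \<Rightarrow> 'e set \<Rightarrow> bool" where
  "is_cycle G C \<longleftrightarrow> C \<subseteq> edges G \<and>
     (\<exists>vs es. es \<noteq> [] \<and> length vs = length es \<and> distinct vs \<and> distinct es \<and> set es = C \<and>
        (\<forall>i<length es. ends G (es ! i) = {vs ! i, vs ! (Suc i mod length es)}))"

definition spanning_forest :: "('v, 'e) mgraph \<Rightarrow> 'e set \<Rightarrow> bool" where
  "spanning_forest G X \<longleftrightarrow> X \<subseteq> edges G \<and> \<not> (\<exists>C. is_cycle G C \<and> C \<subseteq> X)"


section \<open>The spanning forest polynomial\<close>

text \<open>
  Polynomials with integer coefficients in indeterminates indexed by \<open>'e\<close>: finitely supported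
  maps from monomials (finitely supported exponent vectors) to coefficients.
\<close>

type_synonym 'e mpoly = "('e \<Rightarrow>\<^sub>0 nat) \<Rightarrow>\<^sub>0 int"

definition indet :: "'e \<Rightarrow> 'e mpoly" where
  "indet x = Poly_Mapping.single (Poly_Mapping.single x 1) 1"

definition monomial_of :: "'e set \<Rightarrow> 'e mpoly" where
  "monomial_of X = (\<Prod>x\<in>X. indet x)"

definition partial_deriv :: "'e \<Rightarrow> 'e mpoly \<Rightarrow> 'e mpoly" where
  "partial_deriv x p = (\<Sum>m\<in>Poly_Mapping.keys p.
     Poly_Mapping.single (m - Poly_Mapping.single x 1)
       (int (Poly_Mapping.lookup m x) * Poly_Mapping.lookup p m))"

lemma lookup_partial_deriv:
  "Poly_Mapping.lookup (partial_deriv x p) m =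
     int (Poly_Mapping.lookup m x + 1) * Poly_Mapping.lookup p (m + Poly_Mapping.single x 1)"
proof -
  let ?s = "Poly_Mapping.single x (1::nat)"
  have eq: "(if k - ?s = m then int (Poly_Mapping.lookup k x) * Poly_Mapping.lookup p k else 0) =
      (if k = m + ?s then int (Poly_Mapping.lookup k x) * Poly_Mapping.lookup p k else 0)" for k
  proof (cases "Poly_Mapping.lookup k x = 0")
    case False
    then have "k - ?s + ?s = k"
      by (intro poly_mapping_eqI)
        (auto simp: lookup_add lookup_minus lookup_single when_def)
    then show ?thesis by (metis add_diff_cancel_right')
  qed simp
  have "Poly_Mapping.lookup (partial_deriv x p) m =
      (\<Sum>k\<in>Poly_Mapping.keys p.
        if k = m + ?s then int (Poly_Mapping.lookup k x) * Poly_Mapping.lookup p k else 0)"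
    unfolding partial_deriv_def lookup_sum lookup_single when_def eq ..
  also have "\<dots> = int (Poly_Mapping.lookup (m + ?s) x) * Poly_Mapping.lookup p (m + ?s)"
    by (auto simp: sum.delta' in_keys_iff)
  finally show ?thesis by (simp add: lookup_add)
qed

definition forest_poly :: "('v, 'e) mgraph \<Rightarrow> 'e mpoly" where
  "forest_poly G = (\<Sum>X | spanning_forest G X. monomial_of X)"

definition Delta :: "'e mpoly \<Rightarrow> 'e \<Rightarrow> 'e \<Rightarrow> 'e mpoly" where
  "Delta P e f = partial_deriv e P * partial_deriv f P - P * partial_deriv e (partial_deriv f P)"


section \<open>S-sets and A-sets\<close>

definition S_sets :: "('v, 'e) mgraph \<Rightarrow> 'e \<Rightarrow> 'e \<Rightarrow> 'e set set" where
  "S_sets G e f = {S. S \<subseteq> edges G - {e, f} \<and> (\<exists>C. is_cycle G C \<and> S \<union> {e, f} \<subseteq> C)}"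

text \<open>
  The cycle \<open>C\<^sub>A\<close>, for those \<open>A\<close> for which \<open>A \<union> {e, f}\<close> contains exactly one cycle.
\<close>

definition cycle_of :: "('v, 'e) mgraph \<Rightarrow> 'e \<Rightarrow> 'e \<Rightarrow> 'e set \<Rightarrow> 'e set" where
  "cycle_of G e f A = (THE C. is_cycle G C \<and> C \<subseteq> A \<union> {e, f})"

text \<open>
  The unique cycle in the definition of \<open>\<A>(S)\<close> is unique among all cycles contained in
  \<open>A \<union> {e, f}\<close> (so it depends only on \<open>A\<close>, as the notation \<open>C\<^sub>A\<close> indicates), and it is required to
  contain \<open>S \<union> {e, f}\<close>. Uniqueness merely among the cycles containing \<open>S \<union> {e, f}\<close> would make the
  sum-of-squares identity fail already for \<open>K\<^sub>4\<close> minus an edge: with triangles \<open>{e, f, h}\<close> and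
  \<open>{f, p, q}\<close>, it would admit \<open>A = {h, p, q}\<close>, but the identity reads
  \<open>\<Delta>G{e,f} = y\<^sub>h (1 + y\<^sub>h) (1 + y\<^sub>p + y\<^sub>q)\<^sup>2\<close>.
\<close>

definition A_sets :: "('v, 'e) mgraph \<Rightarrow> 'e \<Rightarrow> 'e \<Rightarrow> 'e set \<Rightarrow> 'e set set" where
  "A_sets G e f S =
     {A. A \<subseteq> edges G - {e, f} \<and> spanning_forest G A \<and>
         (\<exists>!C. is_cycle G C \<and> C \<subseteq> A \<union> {e, f}) \<and> S \<union> {e, f} \<subseteq> cycle_of G e f A}"


section \<open>Two-sums, minors and series-parallel graphs\<close>

text \<open>
  \<open>is_two_sum H K g M\<close>: the graph \<open>M\<close> is \<open>H \<oplus>\<^sub>g K\<close>. The maps \<open>\<phi>\<close> and \<open>\<psi>\<close> embed the vertex sets of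
  \<open>H\<close> and \<open>K\<close>, whose images overlap exactly in the identified ends of \<open>g\<close>; since only the sets of
  ends have to agree, both ways of identifying them are allowed. Vertex names of \<open>H\<close> and \<open>K\<close> carry
  no meaning here, while common edge names do.
\<close>

definition is_two_sum ::
  "('v, 'e) mgraph \<Rightarrow> ('v, 'e) mgraph \<Rightarrow> 'e \<Rightarrow> ('v, 'e) mgraph \<Rightarrow> bool" where
  "is_two_sum H K g M \<longleftrightarrow>
     edges H \<inter> edges K = {g} \<and>
     edges M = (edges H \<union> edges K) - {g} \<and>
     (\<exists>\<phi> \<psi>. inj_on \<phi> (verts H) \<and> inj_on \<psi> (verts K) \<and>
        verts M = \<phi> ` verts H \<union> \<psi> ` verts K \<and>
        \<phi> ` verts H \<inter> \<psi> ` verts K = \<phi> ` ends H g \<and>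
        \<phi> ` ends H g = \<psi> ` ends K g \<and>
        (\<forall>x\<in>edges H - {g}. ends M x = \<phi> ` ends H x) \<and>
        (\<forall>x\<in>edges K - {g}. ends M x = \<psi> ` ends K x))"

definition is_K3 :: "('v, 'e) mgraph \<Rightarrow> bool" where
  "is_K3 K \<longleftrightarrow> (\<exists>u v w a b c. distinct [u, v, w] \<and> distinct [a, b, c] \<and>
     verts K = {u, v, w} \<and> edges K = {a, b, c} \<and>
     ends K a = {u, v} \<and> ends K b = {v, w} \<and> ends K c = {w, u})"

definition is_K3_dual :: "('v, 'e) mgraph \<Rightarrow> bool" where
  "is_K3_dual K \<longleftrightarrow> (\<exists>u v a b c. u \<noteq> v \<and> distinct [a, b, c] \<and>
     verts K = {u, v} \<and> edges K = {a, b, c} \<and>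
     ends K a = {u, v} \<and> ends K b = {u, v} \<and> ends K c = {u, v})"

definition delete_edge :: "('v, 'e) mgraph \<Rightarrow> 'e \<Rightarrow> ('v, 'e) mgraph" where
  "delete_edge G x = G\<lparr>edges := edges G - {x}\<rparr>"

definition delete_vertex :: "('v, 'e) mgraph \<Rightarrow> 'v \<Rightarrow> ('v, 'e) mgraph" where
  "delete_vertex G v = G\<lparr>verts := verts G - {v}, edges := {x \<in> edges G. v \<notin> ends G x}\<rparr>"

text \<open>
  Contraction of the non-loop edge \<open>x\<close> with ends \<open>u\<close> and \<open>v\<close>; the merged vertex is called \<open>u\<close>.
  Contracting a loop is the same as deleting it.
\<close>

definition contract_edge :: "('v, 'e) mgraph \<Rightarrow> 'e \<Rightarrow> 'v \<Rightarrow> 'v \<Rightarrow> ('v, 'e) mgraph" where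
  "contract_edge G x u v =
     \<lparr>verts = verts G - {v}, edges = edges G - {x},
      ends = (\<lambda>y. (\<lambda>w. if w = v then u else w) ` ends G y)\<rparr>"

inductive has_minor :: "('v, 'e) mgraph \<Rightarrow> ('v, 'e) mgraph \<Rightarrow> bool" for H where
  refl: "has_minor H H"
| delete_edge: "has_minor H M \<Longrightarrow> x \<in> edges M \<Longrightarrow> has_minor H (delete_edge M x)"
| delete_vertex: "has_minor H M \<Longrightarrow> v \<in> verts M \<Longrightarrow> has_minor H (delete_vertex M v)"
| contract_edge: "has_minor H M \<Longrightarrow> x \<in> edges M \<Longrightarrow> ends M x = {u, v} \<Longrightarrow> u \<noteq> v \<Longrightarrow>
    has_minor H (contract_edge M x u v)"

definition mgraph_iso :: "('v, 'e) mgraph \<Rightarrow> ('w, 'd) mgraph \<Rightarrow> bool" where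
  "mgraph_iso G H \<longleftrightarrow> (\<exists>\<phi> \<psi>. bij_betw \<phi> (verts G) (verts H) \<and> bij_betw \<psi> (edges G) (edges H) \<and>
     (\<forall>x\<in>edges G. ends H (\<psi> x) = \<phi> ` ends G x))"

text \<open>The graphs obtained from a triangle or its dual by series and parallel extensions.\<close>

inductive sp_generated :: "('v, 'e) mgraph \<Rightarrow> bool" where
  K3: "is_K3 G \<Longrightarrow> sp_generated G"
| K3_dual: "is_K3_dual G \<Longrightarrow> sp_generated G"
| series: "sp_generated G \<Longrightarrow> g \<in> edges G \<Longrightarrow> is_K3 K \<Longrightarrow> is_two_sum G K g M \<Longrightarrow> sp_generated M"
| parallel: "sp_generated G \<Longrightarrow> g \<in> edges G \<Longrightarrow> is_K3_dual K \<Longrightarrow> is_two_sum G K g M \<Longrightarrow>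
    sp_generated M"

text \<open>
  The ambient generated graph \<open>H\<close> lives on natural numbers, and minors are taken up to isomorphism:
  the types \<open>'v\<close> and \<open>'e\<close> may be finite and too small to accommodate \<open>H\<close>.
\<close>

definition series_parallel :: "('v, 'e) mgraph \<Rightarrow> bool" where
  "series_parallel G \<longleftrightarrow>
     (\<exists>H M :: (nat, nat) mgraph. sp_generated H \<and> has_minor H M \<and> mgraph_iso G M)"

end

theory Submission
  imports Defs
begin

text \<open>
  All signs can be taken to be \<open>+1\<close>. Everything in the identity depends only on the edge set and on
  the binary cycle space, whose minimal nonempty elements are the cycles; so it makes sense for any
  family \<open>V\<close> of sets closed under symmetric difference. Both sides are quadratic in each \<open>y\<^sub>x\<close>.
  Setting \<open>y\<^sub>x = 0\<close> gives the identity for the deletion of \<open>x\<close>, and the coefficient of \<open>y\<^sub>x\<^sup>2\<close> gives it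
  for the contraction, so it passes to minors. A parallel extension at \<open>g\<close> amounts to the
  substitution \<open>y\<^sub>g = y\<^sub>a + y\<^sub>b\<close>, a series extension to \<open>y\<^sub>g = y\<^sub>a y\<^sub>b / (1 + y\<^sub>a + y\<^sub>b)\<close> after clearing
  denominators.

  For two edges in series the left-hand side becomes \<open>c (c + d)\<close>, where \<open>c\<close> and \<open>d\<close> enumerate the forests
  avoiding \<open>g\<close> that do and do not connect the ends of \<open>g\<close>. One therefore proves simultaneously, for each single
  edge \<open>g\<close>, that \<open>c (c + d)\<close> is the analogous sum of squares over the cycles through \<open>g\<close>.
\<close>

section \<open>Forests and unicyclic sets relative to a cycle space\<close>

definition indep :: "'a set set \<Rightarrow> 'a set \<Rightarrow> bool" where
  "indep V X \<longleftrightarrow> (\<forall>C\<in>V \<inter> Pow X. C = {})"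

definition unicyclic :: "'a set set \<Rightarrow> 'a set \<Rightarrow> 'a set \<Rightarrow> bool" where
  "unicyclic V Y T \<longleftrightarrow>
     (\<exists>C\<in>V \<inter> Pow Y. C \<noteq> {} \<and> T \<subseteq> C \<and> (\<forall>D\<in>V \<inter> Pow Y. D = {} \<or> D = C))"

definition forest_sum :: "'a set set \<Rightarrow> ('a \<Rightarrow> 'r::comm_ring_1) \<Rightarrow> 'a set \<Rightarrow> 'a set \<Rightarrow> 'r" where
  "forest_sum V y D R = (\<Sum>X\<in>Pow D. of_bool (indep V (X \<union> R)) * prod y X)"

definition circuit_sum ::
  "'a set set \<Rightarrow> ('a \<Rightarrow> 'r::comm_ring_1) \<Rightarrow> 'a set \<Rightarrow> 'a set \<Rightarrow> 'a set \<Rightarrow> 'a set \<Rightarrow> 'r" where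
  "circuit_sum V y D R T S =
     (\<Sum>A\<in>Pow D. of_bool (unicyclic V (A \<union> R) (S \<union> T)) * prod y (A - S))"

definition square_sum :: "'a set set \<Rightarrow> ('a \<Rightarrow> 'r::comm_ring_1) \<Rightarrow> 'a set \<Rightarrow> 'a set \<Rightarrow> 'r" where
  "square_sum V y D R = (\<Sum>S\<in>Pow D. prod y S * (circuit_sum V y D R R S)\<^sup>2)"

lemma indep_transfer:
  assumes "V' \<inter> Pow Y' = \<sigma> ` (V \<inter> Pow Y)" "\<And>C. C \<in> V \<Longrightarrow> C \<subseteq> Y \<Longrightarrow> \<sigma> C = {} \<longleftrightarrow> C = {}"
  shows "indep V' Y' \<longleftrightarrow> indep V Y"
  unfolding indep_def assms(1) using assms(2) by auto

lemma unicyclic_transfer: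
  assumes "V' \<inter> Pow Y' = \<sigma> ` (V \<inter> Pow Y)" "inj_on \<sigma> (V \<inter> Pow Y)"
    and "\<And>C. C \<in> V \<Longrightarrow> C \<subseteq> Y \<Longrightarrow> \<sigma> C = {} \<longleftrightarrow> C = {}"
    and "\<And>C. C \<in> V \<Longrightarrow> C \<subseteq> Y \<Longrightarrow> T' \<subseteq> \<sigma> C \<longleftrightarrow> T \<subseteq> C"
  shows "unicyclic V' Y' T' \<longleftrightarrow> unicyclic V Y T"
proof -
  have "unicyclic V' Y' T' \<longleftrightarrow>
      (\<exists>C\<in>V \<inter> Pow Y. \<sigma> C \<noteq> {} \<and> T' \<subseteq> \<sigma> C \<and>
      (\<forall>D\<in>V \<inter> Pow Y. \<sigma> D = {} \<or> \<sigma> D = \<sigma> C))"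
    unfolding unicyclic_def assms(1) by simp
  also have "\<dots> \<longleftrightarrow> (\<exists>C\<in>V \<inter> Pow Y. C \<noteq> {} \<and> T \<subseteq> C \<and> (\<forall>D\<in>V \<inter> Pow Y. D = {} \<or> D = C))"
  proof (intro bex_cong HOL.refl)
    fix C assume C: "C \<in> V \<inter> Pow Y"
    have "\<sigma> D = {} \<or> \<sigma> D = \<sigma> C \<longleftrightarrow> D = {} \<or> D = C" if "D \<in> V \<inter> Pow Y" for D
      using that C assms(3)[of D] inj_onD[OF assms(2), of D C] by auto
    then show "(\<sigma> C \<noteq> {} \<and> T' \<subseteq> \<sigma> C \<and> (\<forall>D\<in>V \<inter> Pow Y. \<sigma> D = {} \<or> \<sigma> D = \<sigma> C)) =
        (C \<noteq> {} \<and> T \<subseteq> C \<and> (\<forall>D\<in>V \<inter> Pow Y. D = {} \<or> D = C))"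
      using C assms(3)[of C] assms(4)[of C] by auto
  qed
  also have "\<dots> \<longleftrightarrow> unicyclic V Y T" unfolding unicyclic_def ..
  finally show ?thesis .
qed

lemma unicyclicE:
  assumes "unicyclic V Y T"
  obtains C where "C \<in> V" "C \<subseteq> Y" "C \<noteq> {}" "T \<subseteq> C" "\<And>D. D \<in> V \<Longrightarrow> D \<subseteq> Y \<Longrightarrow> D = {} \<or> D = C"
proof -
  from assms obtain C where C: "C \<in> V \<inter> Pow Y" "C \<noteq> {}" "T \<subseteq> C" "\<forall>D\<in>V \<inter> Pow Y. D = {} \<or> D = C"
    unfolding unicyclic_def by (elim bexE conjE)
  have "D = {} \<or> D = C" if "D \<in> V" "D \<subseteq> Y" for D
    using C(4) that by (metis IntI PowI)
  then show ?thesis using that[of C] C(1-3) by simp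
qed

lemma unicyclicI:
  assumes "C \<in> V" "C \<subseteq> Y" "C \<noteq> {}" "T \<subseteq> C" "\<And>D. D \<in> V \<Longrightarrow> D \<subseteq> Y \<Longrightarrow> D = {} \<or> D = C"
  shows "unicyclic V Y T"
  unfolding unicyclic_def using assms by (intro bexI[of _ C]) simp_all

lemma indepI: "(\<And>C. C \<in> V \<Longrightarrow> C \<subseteq> X \<Longrightarrow> C = {}) \<Longrightarrow> indep V X"
  unfolding indep_def by simp

lemma indepD: "indep V X \<Longrightarrow> C \<in> V \<Longrightarrow> C \<subseteq> X \<Longrightarrow> C = {}"
  unfolding indep_def by simp

lemma not_unicyclic: "\<not> T \<subseteq> Y \<Longrightarrow> \<not> unicyclic V Y T"
  unfolding unicyclic_def by auto

lemma sum_Pow_insert: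
  assumes "finite D" "x \<notin> D"
  shows "(\<Sum>X\<in>Pow (insert x D). h X) = (\<Sum>X\<in>Pow D. h X + h (insert x X))"
proof -
  have "inj_on (insert x) (Pow D)" using assms(2) by (auto simp: inj_on_def)
  moreover have "Pow D \<inter> insert x ` Pow D = {}" using assms(2) by auto
  ultimately show ?thesis
    using assms(1) by (simp add: Pow_insert sum.union_disjoint sum.reindex sum.distrib)
qed

lemma forest_sum_insert:
  assumes "finite D" "x \<notin> D"
  shows "forest_sum V y (insert x D) R = forest_sum V y D R + y x * forest_sum V y D (insert x R)"
proof -
  have "prod y (insert x X) = y x * prod y X" if "X \<subseteq> D" for X
    using that assms by (subst prod.insert) (auto intro: finite_subset)
  then show ?thesis
    unfolding forest_sum_def sum_Pow_insert[OF assms] sum.distrib sum_distrib_left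
    by (auto intro!: arg_cong2[where f="(+)"] sum.cong)
qed

lemma circuit_sum_insert:
  assumes "finite D" "x \<notin> D" "S \<subseteq> D"
  shows "circuit_sum V y (insert x D) R T S =
    circuit_sum V y D R T S + y x * circuit_sum V y D (insert x R) T S"
proof -
  have "prod y (insert x A - S) = y x * prod y (A - S)" if "A \<subseteq> D" for A
  proof -
    have "insert x A - S = insert x (A - S)" "x \<notin> A - S" using that assms by auto
    moreover have "finite (A - S)" using that assms by (auto intro: finite_subset)
    ultimately show ?thesis by simp
  qed
  then show ?thesis
    unfolding circuit_sum_def sum_Pow_insert[OF assms(1,2)] sum.distrib sum_distrib_left
    by (auto intro!: arg_cong2[where f="(+)"] sum.cong)
qed

lemma circuit_sum_insert_insert:
  assumes "finite D" "x \<notin> D" "S \<subseteq> D" "x \<notin> R"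
  shows "circuit_sum V y (insert x D) R T (insert x S) = circuit_sum V y D (insert x R) (insert x T) S"
proof -
  have "\<not> unicyclic V (A \<union> R) (insert x S \<union> T)" if "A \<subseteq> D" for A
    using that assms by (intro not_unicyclic) auto
  moreover have "A - insert x S = A - S" "insert x A - insert x S = A - S" if "A \<subseteq> D" for A
    using that assms by auto
  ultimately show ?thesis
    unfolding circuit_sum_def sum_Pow_insert[OF assms(1,2)]
    by (auto intro!: sum.cong)
qed

lemma square_sum_insert:
  assumes "finite D" "x \<notin> D" "x \<notin> R"
  shows "square_sum V y (insert x D) R = (\<Sum>S\<in>Pow D. prod y S *
    ((circuit_sum V y D R R S + y x * circuit_sum V y D (insert x R) R S)\<^sup>2
      + y x * (circuit_sum V y D (insert x R) (insert x R) S)\<^sup>2))"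
proof -
  have "prod y (insert x S) = y x * prod y S" if "S \<subseteq> D" for S
    using that assms by (subst prod.insert) (auto intro: finite_subset)
  then show ?thesis
    unfolding square_sum_def sum_Pow_insert[OF assms(1,2)]
    using assms
    by (intro sum.cong) (auto simp: circuit_sum_insert circuit_sum_insert_insert algebra_simps)
qed

lemma square_sum_insert2:
  assumes "finite D" "a \<notin> D" "b \<notin> D" "a \<noteq> b" "a \<notin> R" "b \<notin> R"
  shows "square_sum V y (insert a (insert b D)) R = (\<Sum>S\<in>Pow D. prod y S *
    ((circuit_sum V y D R R S + y a * circuit_sum V y D (insert a R) R S
        + y b * circuit_sum V y D (insert b R) R S
        + y a * y b * circuit_sum V y D (insert a (insert b R)) R S)\<^sup>2
      + y a * (circuit_sum V y D (insert a R) (insert a R) S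
        + y b * circuit_sum V y D (insert a (insert b R)) (insert a R) S)\<^sup>2
      + y b * (circuit_sum V y D (insert b R) (insert b R) S
        + y a * circuit_sum V y D (insert a (insert b R)) (insert b R) S)\<^sup>2
      + y a * y b * (circuit_sum V y D (insert a (insert b R)) (insert a (insert b R)) S)\<^sup>2))"
proof -
  have w: "prod y (insert b S) = y b * prod y S" if "S \<subseteq> D" for S
    using that assms by (subst prod.insert) (auto intro: finite_subset)
  have a: "finite (insert b D)" "a \<notin> insert b D" using assms by auto
  show ?thesis
    unfolding square_sum_insert[OF a assms(5)] sum_Pow_insert[OF assms(1,3)]
    using assms
    by (intro sum.cong HOL.refl)
      (simp add: Pow_iff w circuit_sum_insert circuit_sum_insert_insert insert_commute[of b a] algebra_simps)
qed

lemma forest_sum_cong: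
  assumes "\<And>X. X \<subseteq> D \<Longrightarrow> indep V' (X \<union> R') = indep V (X \<union> R)" "\<And>x. x \<in> D \<Longrightarrow> y' x = y x"
  shows "forest_sum V' y' D R' = forest_sum V y D R"
proof -
  have "prod y' X = prod y X" if "X \<subseteq> D" for X
    using that assms(2) by (intro prod.cong) auto
  then show ?thesis unfolding forest_sum_def using assms(1) by (intro sum.cong) auto
qed

lemma circuit_sum_cong:
  assumes "\<And>A. A \<subseteq> D \<Longrightarrow> unicyclic V' (A \<union> R') (S' \<union> T') = unicyclic V (A \<union> R) (S \<union> T)"
    and "\<And>A. A \<subseteq> D \<Longrightarrow> A - S' = A - S"
    and "\<And>x. x \<in> D \<Longrightarrow> y' x = y x"
  shows "circuit_sum V' y' D R' T' S' = circuit_sum V y D R T S"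
proof -
  have "prod y' (A - S') = prod y (A - S)" if "A \<subseteq> D" for A
    using that assms(2,3) by (intro prod.cong) auto
  then show ?thesis unfolding circuit_sum_def using assms(1) by (intro sum.cong) auto
qed

lemma circuit_sum_eq_0:
  assumes "\<And>A. A \<subseteq> D \<Longrightarrow> \<not> unicyclic V (A \<union> R) (S \<union> T)"
  shows "circuit_sum V y D R T S = 0"
  unfolding circuit_sum_def using assms by (intro sum.neutral) auto

definition sym_diff_closed :: "'a set set \<Rightarrow> bool" where
  "sym_diff_closed V \<longleftrightarrow> (\<forall>C\<in>V. \<forall>D\<in>V. sym_diff C D \<in> V)"

lemma unicyclic_insert:
  assumes "sym_diff_closed V" "indep V X"
  shows "unicyclic V (insert g X) {g} \<longleftrightarrow> \<not> indep V (insert g X)"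
proof
  assume "\<not> indep V (insert g X)"
  then obtain C where C: "C \<in> V" "C \<subseteq> insert g X" "C \<noteq> {}" unfolding indep_def by auto
  have g: "g \<in> D" if "D \<in> V" "D \<subseteq> insert g X" "D \<noteq> {}" for D
    using that indepD[OF assms(2) that(1)] by auto
  have eq: "D = C" if D: "D \<in> V" "D \<subseteq> insert g X" "D \<noteq> {}" for D
  proof -
    have "sym_diff C D \<in> V" using assms(1) C(1) D(1) unfolding sym_diff_closed_def by simp
    moreover have "sym_diff C D \<subseteq> X" using g[OF C] g[OF D] C(2) D(2) by auto
    ultimately have "sym_diff C D = {}" by (rule indepD[OF assms(2)])
    then show ?thesis by auto
  qed
  show "unicyclic V (insert g X) {g}"
  proof (rule unicyclicI[OF C])
    show "D = {} \<or> D = C" if "D \<in> V" "D \<subseteq> insert g X" for D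
      using eq[OF that] by blast
  qed (use g[OF C] in simp)
next
  assume "unicyclic V (insert g X) {g}"
  then obtain C where "C \<in> V" "C \<subseteq> insert g X" "C \<noteq> {}" by (rule unicyclicE)
  then show "\<not> indep V (insert g X)" using indepD[of V _ C] by auto
qed

lemma indep_subset: "indep V Y \<Longrightarrow> X \<subseteq> Y \<Longrightarrow> indep V X"
  unfolding indep_def by (meson Int_iff Pow_iff subset_trans)

lemma unicyclic_indep:
  assumes "unicyclic V (insert g X) T" "g \<in> T" "g \<notin> X"
  shows "indep V X"
proof (rule indepI)
  fix D assume D: "D \<in> V" "D \<subseteq> X"
  obtain C where C: "T \<subseteq> C" "\<And>D. D \<in> V \<Longrightarrow> D \<subseteq> insert g X \<Longrightarrow> D = {} \<or> D = C"
    by (rule unicyclicE[OF assms(1)]) (rule that)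
  have "D \<noteq> C" using D C(1) assms(2,3) by auto
  moreover have "D \<subseteq> insert g X" using D by auto
  ultimately show "D = {}" using C(2)[OF D(1)] by simp
qed

lemma forest_sum_split:
  assumes "sym_diff_closed V" "g \<notin> D"
  shows "forest_sum V y D {} = circuit_sum V y D {g} {g} {} + forest_sum V y D {g}"
proof -
  have "of_bool (indep V (X \<union> {})) * prod y X =
      of_bool (unicyclic V (X \<union> {g}) ({} \<union> {g})) * prod y (X - {}) + of_bool (indep V (X \<union> {g})) * prod y X"
    if "X \<in> Pow D" for X
  proof (cases "indep V X")
    case True
    then show ?thesis using unicyclic_insert[OF assms(1), of X g] by simp
  next
    case False
    then show ?thesis
      using that assms(2) unicyclic_indep[of V g X "{g}"] indep_subset[of V "insert g X" X] by auto
  qed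
  then show ?thesis
    unfolding forest_sum_def circuit_sum_def sum.distrib[symmetric] by (rule sum.cong[OF HOL.refl])
qed

definition pair_identity :: "'a set set \<Rightarrow> ('a \<Rightarrow> 'r::comm_ring_1) \<Rightarrow> 'a set \<Rightarrow> 'a \<Rightarrow> 'a \<Rightarrow> bool" where
  "pair_identity V y D e f \<longleftrightarrow>
     forest_sum V y D {e} * forest_sum V y D {f} - forest_sum V y D {} * forest_sum V y D {e, f}
       = square_sum V y D {e, f}"

definition edge_identity :: "'a set set \<Rightarrow> ('a \<Rightarrow> 'r::comm_ring_1) \<Rightarrow> 'a set \<Rightarrow> 'a \<Rightarrow> bool" where
  "edge_identity V y D g \<longleftrightarrow>
     circuit_sum V y D {g} {g} {} * forest_sum V y D {} = square_sum V y D {g}"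

lemma pair_identity_commute: "pair_identity V y D e f \<longleftrightarrow> pair_identity V y D f e"
  unfolding pair_identity_def by (simp add: insert_commute mult.commute)

section \<open>Series and parallel extensions\<close>

definition parallel_space :: "'a set set \<Rightarrow> 'a set \<Rightarrow> 'a \<Rightarrow> 'a \<Rightarrow> 'a \<Rightarrow> 'a set set" where
  "parallel_space V E g a b = {C. C \<subseteq> insert a (insert b (E - {g})) \<and>
     (C - {a, b}) \<union> (if a \<in> C \<longleftrightarrow> b \<in> C then {} else {g}) \<in> V}"

definition series_space :: "'a set set \<Rightarrow> 'a set \<Rightarrow> 'a \<Rightarrow> 'a \<Rightarrow> 'a \<Rightarrow> 'a set set" where
  "series_space V E g a b = {C. C \<subseteq> insert a (insert b (E - {g})) \<and> (a \<in> C \<longleftrightarrow> b \<in> C) \<and>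
     (C - {a, b}) \<union> (if a \<in> C then {g} else {}) \<in> V}"

lemma parallel_space_commute: "parallel_space V E g a b = parallel_space V E g b a"
proof -
  have "(a \<in> C \<longleftrightarrow> b \<in> C) \<longleftrightarrow> (b \<in> C \<longleftrightarrow> a \<in> C)" for C :: "'a set" by auto
  then show ?thesis
    unfolding parallel_space_def by (simp only: insert_commute)
qed

lemma series_space_commute: "series_space V E g a b = series_space V E g b a"
proof -
  have "(a \<in> C \<longleftrightarrow> b \<in> C) \<and> (C - {a, b}) \<union> (if a \<in> C then {g} else {}) \<in> V \<longleftrightarrow>
      (b \<in> C \<longleftrightarrow> a \<in> C) \<and> (C - {b, a}) \<union> (if b \<in> C then {g} else {}) \<in> V" for C :: "'a set"
    by (auto simp: insert_commute)
  then show ?thesis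
    unfolding series_space_def by (simp only: insert_commute)
qed

definition replace_by :: "'a \<Rightarrow> 'a set \<Rightarrow> 'a set \<Rightarrow> 'a set" where
  "replace_by g P C = (if g \<in> C then P \<union> (C - {g}) else C)"

lemma replace_by_empty_iff: "P \<noteq> {} \<Longrightarrow> replace_by g P C = {} \<longleftrightarrow> C = {}"
  unfolding replace_by_def by auto

lemma inj_on_replace_by:
  assumes "P \<noteq> {}" "P \<inter> insert g X = {}"
  shows "inj_on (replace_by g P) (Pow (insert g X))"
proof (rule inj_onI)
  fix C D assume C: "C \<in> Pow (insert g X)" and D: "D \<in> Pow (insert g X)"
    and eq: "replace_by g P C = replace_by g P D"
  have m: "g \<in> B \<longleftrightarrow> P \<subseteq> replace_by g P B" if "B \<in> Pow (insert g X)" for B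
    using assms that unfolding replace_by_def by auto
  have d: "replace_by g P B - P = B - {g}" if "B \<in> Pow (insert g X)" for B
    using assms that unfolding replace_by_def by auto
  show "C = D" using m[OF C] m[OF D] d[OF C] d[OF D] unfolding eq by blast
qed

locale edge_replacement =
  fixes V V' :: "'a set set" and g :: 'a and P X :: "'a set"
  assumes nonempty: "P \<noteq> {}" and disjoint: "P \<inter> insert g X = {}"
    and space: "V' \<inter> Pow (P \<union> X) = replace_by g P ` (V \<inter> Pow (insert g X))"
begin

lemma indep_iff: "indep V' (P \<union> X) \<longleftrightarrow> indep V (insert g X)"
  using space replace_by_empty_iff[OF nonempty] by (rule indep_transfer)

lemma unicyclic_iff:
  assumes "T \<inter> insert g P = {}"
  shows "unicyclic V' (P \<union> X) T \<longleftrightarrow> unicyclic V (insert g X) T"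
proof (rule unicyclic_transfer[OF space _ replace_by_empty_iff[OF nonempty]])
  show "inj_on (replace_by g P) (V \<inter> Pow (insert g X))"
    using inj_on_replace_by[OF nonempty disjoint] by (rule inj_on_subset) simp
  show "T \<subseteq> replace_by g P C \<longleftrightarrow> T \<subseteq> C" for C
    using assms unfolding replace_by_def by auto
qed

lemma unicyclic_Un_iff:
  assumes "T \<inter> insert g P = {}" "Q \<subseteq> P" "Q \<noteq> {}"
  shows "unicyclic V' (P \<union> X) (Q \<union> T) \<longleftrightarrow> unicyclic V (insert g X) (insert g T)"
proof (rule unicyclic_transfer[OF space _ replace_by_empty_iff[OF nonempty]])
  show "inj_on (replace_by g P) (V \<inter> Pow (insert g X))"
    using inj_on_replace_by[OF nonempty disjoint] by (rule inj_on_subset) simp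
  show "Q \<union> T \<subseteq> replace_by g P C \<longleftrightarrow> insert g T \<subseteq> C" if "C \<subseteq> insert g X" for C
  proof -
    have "Q \<inter> C = {}" "g \<notin> Q" "g \<notin> P" using assms(2) disjoint that by auto
    then have "g \<in> C" if "Q \<union> T \<subseteq> replace_by g P C"
      using that assms(3) unfolding replace_by_def by (cases "g \<in> C") auto
    then show ?thesis using assms unfolding replace_by_def by auto
  qed
qed

end

lemma indep_cong: "V' \<inter> Pow X' = V \<inter> Pow X \<Longrightarrow> indep V' X' = indep V X"
  unfolding indep_def by simp

lemma unicyclic_cong: "V' \<inter> Pow X' = V \<inter> Pow X \<Longrightarrow> unicyclic V' X' T = unicyclic V X T"
  unfolding unicyclic_def by simp

locale extension =
  fixes V :: "'a set set" and E :: "'a set" and g a b :: 'a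
  assumes V_subset: "V \<subseteq> Pow E" and sym_diff_closed: "sym_diff_closed V" and empty_in: "{} \<in> V"
    and finite_E: "finite E" and g_in: "g \<in> E" and a_notin: "a \<notin> E" and b_notin: "b \<notin> E"
    and a_neq_b: "a \<noteq> b"
begin

lemma commute: "extension V E g b a"
  using extension_axioms unfolding extension_def by auto

abbreviation "par \<equiv> parallel_space V E g a b"
abbreviation "ser \<equiv> series_space V E g a b"

lemma par_Pow:
  assumes "X \<subseteq> E - {g}"
  shows "par \<inter> Pow X = V \<inter> Pow X"
proof -
  have "C \<in> par \<longleftrightarrow> C \<in> V" if "C \<subseteq> X" for C
  proof -
    have "a \<notin> C" "b \<notin> C" "C \<subseteq> insert a (insert b (E - {g}))" "C - {a, b} = C"
      using that assms a_notin b_notin by auto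
    then show ?thesis unfolding parallel_space_def by simp
  qed
  then show ?thesis by auto
qed

lemma par_insert:
  assumes "X \<subseteq> E - {g}"
  shows "edge_replacement V par g {a} X"
proof
  show "{a} \<noteq> {}" "{a} \<inter> insert g X = {}" using assms a_notin g_in by auto
  have mem: "replace_by g {a} C \<in> par \<longleftrightarrow> C \<in> V" if "C \<subseteq> insert g X" for C
  proof -
    have "replace_by g {a} C \<subseteq> insert a (insert b (E - {g}))" "b \<notin> replace_by g {a} C"
        "a \<in> replace_by g {a} C \<longleftrightarrow> g \<in> C" "replace_by g {a} C - {a, b} = C - {g}"
      using that assms a_notin b_notin a_neq_b g_in unfolding replace_by_def by auto
    moreover have "C - {g} \<union> (if g \<in> C \<longleftrightarrow> False then {} else {g}) = C" by auto
    ultimately show ?thesis unfolding parallel_space_def by (simp only: mem_Collect_eq simp_thms)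
  qed
  have surj: "\<exists>D\<subseteq>insert g X. replace_by g {a} D = C" if "C \<subseteq> insert a X" for C
  proof (rule exI[of _ "replace_by a {g} C"], intro conjI)
    show "replace_by a {g} C \<subseteq> insert g X" using that unfolding replace_by_def by auto
    have "g \<notin> C" using that assms a_notin g_in by auto
    then show "replace_by g {a} (replace_by a {g} C) = C"
      unfolding replace_by_def by auto
  qed
  have sub: "replace_by g {a} D \<subseteq> insert a X" if "D \<subseteq> insert g X" for D
    using that unfolding replace_by_def by auto
  show "par \<inter> Pow ({a} \<union> X) = replace_by g {a} ` (V \<inter> Pow (insert g X))"
  proof (intro set_eqI iffI)
    fix C assume "C \<in> par \<inter> Pow ({a} \<union> X)"
    then have C: "C \<in> par" "C \<subseteq> insert a X" by simp_all
    obtain D where "D \<subseteq> insert g X" "replace_by g {a} D = C" using surj[OF C(2)] by metis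
    then show "C \<in> replace_by g {a} ` (V \<inter> Pow (insert g X))" using mem[of D] C(1) by auto
  next
    fix C assume "C \<in> replace_by g {a} ` (V \<inter> Pow (insert g X))"
    then show "C \<in> par \<inter> Pow ({a} \<union> X)" using mem sub by auto
  qed
qed

lemma ab_in_par: "{a, b} \<in> par"
  using empty_in unfolding parallel_space_def by auto

lemma unicyclic_par_insert2:
  assumes "X \<subseteq> E - {g}"
  shows "unicyclic par (insert a (insert b X)) T \<longleftrightarrow> T \<subseteq> {a, b} \<and> indep V (insert g X)"
proof
  assume "unicyclic par (insert a (insert b X)) T"
  then obtain C where C: "C \<in> par" "C \<noteq> {}" "T \<subseteq> C"
    "\<And>D. D \<in> par \<Longrightarrow> D \<subseteq> insert a (insert b X) \<Longrightarrow> D = {} \<or> D = C" by (rule unicyclicE) (rule that)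
  have ab: "C = {a, b}" using C(4)[OF ab_in_par] by auto
  interpret edge_replacement V par g "{a}" X by (rule par_insert[OF assms])
  have "indep par ({a} \<union> X)"
  proof (rule indepI)
    fix D assume D: "D \<in> par" "D \<subseteq> {a} \<union> X"
    have "b \<notin> D" using D(2) assms b_notin a_neq_b by auto
    moreover have "D \<subseteq> insert a (insert b X)" using D(2) by auto
    ultimately show "D = {}" using C(4)[OF D(1)] ab by auto
  qed
  then show "T \<subseteq> {a, b} \<and> indep V (insert g X)" using C(3) ab indep_iff by simp
next
  assume T: "T \<subseteq> {a, b} \<and> indep V (insert g X)"
  show "unicyclic par (insert a (insert b X)) T"
  proof (rule unicyclicI[OF ab_in_par])
    fix D assume D: "D \<in> par" "D \<subseteq> insert a (insert b X)"
    have "D - {a, b} \<union> (if a \<in> D \<longleftrightarrow> b \<in> D then {} else {g}) \<in> V"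
      using D(1) unfolding parallel_space_def by simp
    moreover have "D - {a, b} \<union> (if a \<in> D \<longleftrightarrow> b \<in> D then {} else {g}) \<subseteq> insert g X"
      using D(2) by auto
    ultimately have "D - {a, b} \<union> (if a \<in> D \<longleftrightarrow> b \<in> D then {} else {g}) = {}"
      using indepD T by metis
    then show "D = {} \<or> D = {a, b}" by (auto split: if_splits)
  qed (use T in auto)
qed

lemma not_indep_par_insert2: "\<not> indep par (insert a (insert b X))"
proof
  assume "indep par (insert a (insert b X))"
  then have "{a, b} = {}" by (rule indepD) (use ab_in_par in auto)
  then show False by simp
qed

lemma ser_Pow:
  assumes "X \<subseteq> E - {g}" "c \<in> {a, b}"
  shows "ser \<inter> Pow (insert c X) = V \<inter> Pow X"
proof -
  have "C \<in> ser \<longleftrightarrow> C \<in> V \<and> C \<subseteq> X" if "C \<subseteq> insert c X" for C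
  proof (cases "c \<in> C")
    case True
    then have "C \<notin> ser" using that assms a_notin b_notin a_neq_b unfolding series_space_def by auto
    then show ?thesis using True assms a_notin b_notin by auto
  next
    case False
    then have "a \<notin> C" "b \<notin> C" "C \<subseteq> insert a (insert b (E - {g}))" "C - {a, b} = C"
      using that assms a_notin b_notin by auto
    then show ?thesis using that False unfolding series_space_def by auto
  qed
  then show ?thesis by auto
qed

lemma ser_Pow': "X \<subseteq> E - {g} \<Longrightarrow> ser \<inter> Pow X = V \<inter> Pow X"
  using ser_Pow[of X a] by auto

lemma ser_insert:
  assumes "X \<subseteq> E - {g}"
  shows "edge_replacement V ser g {a, b} X"
proof
  show "{a, b} \<noteq> {}" "{a, b} \<inter> insert g X = {}" using assms a_notin b_notin g_in by auto
  have mem: "replace_by g {a, b} C \<in> ser \<longleftrightarrow> C \<in> V" if "C \<subseteq> insert g X" for C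
  proof -
    have "replace_by g {a, b} C \<subseteq> insert a (insert b (E - {g}))"
        "b \<in> replace_by g {a, b} C \<longleftrightarrow> g \<in> C"
        "a \<in> replace_by g {a, b} C \<longleftrightarrow> g \<in> C" "replace_by g {a, b} C - {a, b} = C - {g}"
      using that assms a_notin b_notin a_neq_b g_in unfolding replace_by_def by auto
    moreover have "C - {g} \<union> (if g \<in> C then {g} else {}) = C" by auto
    ultimately show ?thesis unfolding series_space_def by simp
  qed
  have sub: "replace_by g {a, b} D \<subseteq> insert a (insert b X)" if "D \<subseteq> insert g X" for D
    using that unfolding replace_by_def by auto
  have surj: "\<exists>D\<subseteq>insert g X. replace_by g {a, b} D = C"
    if "C \<subseteq> insert a (insert b X)" "a \<in> C \<longleftrightarrow> b \<in> C" for C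
  proof (rule exI[of _ "C - {a, b} \<union> (if a \<in> C then {g} else {})"], intro conjI)
    show "C - {a, b} \<union> (if a \<in> C then {g} else {}) \<subseteq> insert g X" using that by auto
    have "g \<notin> C" using that assms a_notin b_notin g_in by auto
    then show "replace_by g {a, b} (C - {a, b} \<union> (if a \<in> C then {g} else {})) = C"
      using that(2) unfolding replace_by_def by auto
  qed
  show "ser \<inter> Pow ({a, b} \<union> X) = replace_by g {a, b} ` (V \<inter> Pow (insert g X))"
  proof (intro set_eqI iffI)
    fix C assume "C \<in> ser \<inter> Pow ({a, b} \<union> X)"
    then have C: "C \<in> ser" "C \<subseteq> insert a (insert b X)" "a \<in> C \<longleftrightarrow> b \<in> C"
      unfolding series_space_def by auto
    obtain D where "D \<subseteq> insert g X" "replace_by g {a, b} D = C" using surj[OF C(2,3)] by metis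
    then show "C \<in> replace_by g {a, b} ` (V \<inter> Pow (insert g X))" using mem[of D] C(1) by auto
  next
    fix C assume "C \<in> replace_by g {a, b} ` (V \<inter> Pow (insert g X))"
    then show "C \<in> ser \<inter> Pow ({a, b} \<union> X)" using mem sub by auto
  qed
qed

lemma forest_sum_par:
  assumes "D \<subseteq> E - {g}" "R \<subseteq> E - {g}"
  shows "forest_sum par y D R = forest_sum V y D R"
    and "forest_sum par y D (insert a R) = forest_sum V y D (insert g R)"
    and "forest_sum par y D (insert a (insert b R)) = 0"
proof -
  have X: "X \<union> R \<subseteq> E - {g}" if "X \<subseteq> D" for X using that assms by auto
  show "forest_sum par y D R = forest_sum V y D R"
    by (rule forest_sum_cong[OF indep_cong[OF par_Pow[OF X]] HOL.refl])
  show "forest_sum par y D (insert a R) = forest_sum V y D (insert g R)"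
    by (rule forest_sum_cong) (use edge_replacement.indep_iff[OF par_insert[OF X]] in simp_all)
  show "forest_sum par y D (insert a (insert b R)) = 0"
    unfolding forest_sum_def using not_indep_par_insert2 by (intro sum.neutral) simp
qed

lemma circuit_sum_par:
  assumes "D \<subseteq> E - {g}" "R \<subseteq> E - {g}" "T \<subseteq> E - {g}" "S \<subseteq> D"
  shows "circuit_sum par y D R T S = circuit_sum V y D R T S"
    and "circuit_sum par y D (insert a R) T S = circuit_sum V y D (insert g R) T S"
    and "circuit_sum par y D (insert a R) (insert a T) S =
      circuit_sum V y D (insert g R) (insert g T) S"
proof -
  have X: "A \<union> R \<subseteq> E - {g}" if "A \<subseteq> D" for A using that assms by auto
  have T: "(S \<union> T) \<inter> insert g {a} = {}" using assms a_notin by auto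
  show "circuit_sum par y D R T S = circuit_sum V y D R T S"
    by (rule circuit_sum_cong[OF unicyclic_cong[OF par_Pow[OF X]] HOL.refl HOL.refl])
  show "circuit_sum par y D (insert a R) T S = circuit_sum V y D (insert g R) T S"
    by (rule circuit_sum_cong) (use edge_replacement.unicyclic_iff[OF par_insert[OF X] T] in simp_all)
  show "circuit_sum par y D (insert a R) (insert a T) S =
      circuit_sum V y D (insert g R) (insert g T) S"
    by (rule circuit_sum_cong)
      (use edge_replacement.unicyclic_Un_iff[OF par_insert[OF X] T, of _ "{a}"] in simp_all)
qed

lemma circuit_sum_par_insert2:
  assumes "D \<subseteq> E - {g}" "R \<subseteq> E - {g}"
  shows "circuit_sum par y D (insert a (insert b R)) T S =
    of_bool (S \<union> T \<subseteq> {a, b}) * (\<Sum>A\<in>Pow D. of_bool (indep V (A \<union> insert g R)) * prod y (A - S))"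
proof -
  have X: "A \<union> R \<subseteq> E - {g}" if "A \<subseteq> D" for A using that assms by auto
  show ?thesis
    unfolding circuit_sum_def sum_distrib_left
    using unicyclic_par_insert2[OF X, of _ "S \<union> T"] by (intro sum.cong) auto
qed

lemma forest_sum_ser:
  assumes "D \<subseteq> E - {g}" "R \<subseteq> E - {g}"
  shows "forest_sum ser y D R = forest_sum V y D R"
    and "forest_sum ser y D (insert a R) = forest_sum V y D R"
    and "forest_sum ser y D (insert a (insert b R)) = forest_sum V y D (insert g R)"
proof -
  have X: "X \<union> R \<subseteq> E - {g}" if "X \<subseteq> D" for X using that assms by auto
  show "forest_sum ser y D R = forest_sum V y D R"
    by (rule forest_sum_cong[OF indep_cong[OF ser_Pow'[OF X]] HOL.refl])
  show "forest_sum ser y D (insert a R) = forest_sum V y D R"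
    by (rule forest_sum_cong) (use indep_cong[OF ser_Pow[OF X, of _ a]] in simp_all)
  show "forest_sum ser y D (insert a (insert b R)) = forest_sum V y D (insert g R)"
    by (rule forest_sum_cong) (use edge_replacement.indep_iff[OF ser_insert[OF X]] in simp_all)
qed

lemma circuit_sum_ser:
  assumes "D \<subseteq> E - {g}" "R \<subseteq> E - {g}" "T \<subseteq> E - {g}" "S \<subseteq> D"
  shows "circuit_sum ser y D R T S = circuit_sum V y D R T S"
    and "circuit_sum ser y D (insert a R) T S = circuit_sum V y D R T S"
    and "circuit_sum ser y D (insert a R) (insert a T) S = 0"
    and "circuit_sum ser y D (insert a (insert b R)) T S = circuit_sum V y D (insert g R) T S"
    and "circuit_sum ser y D (insert a (insert b R)) (insert a T) S =
      circuit_sum V y D (insert g R) (insert g T) S"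
    and "circuit_sum ser y D (insert a (insert b R)) (insert a (insert b T)) S =
      circuit_sum V y D (insert g R) (insert g T) S"
proof -
  have X: "A \<union> R \<subseteq> E - {g}" if "A \<subseteq> D" for A using that assms by auto
  have T: "(S \<union> T) \<inter> insert g {a, b} = {}" using assms a_notin b_notin by auto
  show "circuit_sum ser y D R T S = circuit_sum V y D R T S"
    by (rule circuit_sum_cong[OF unicyclic_cong[OF ser_Pow'[OF X]] HOL.refl HOL.refl])
  show "circuit_sum ser y D (insert a R) T S = circuit_sum V y D R T S"
    by (rule circuit_sum_cong) (use unicyclic_cong[OF ser_Pow[OF X, of _ a]] in simp_all)
  show "circuit_sum ser y D (insert a R) (insert a T) S = 0"
  proof (rule circuit_sum_eq_0)
    fix A assume A: "A \<subseteq> D"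
    have "a \<notin> A \<union> R" using A assms a_notin by auto
    then have "\<not> unicyclic V (A \<union> R) (S \<union> insert a T)" by (intro not_unicyclic) auto
    then show "\<not> unicyclic ser (A \<union> insert a R) (S \<union> insert a T)"
      using unicyclic_cong[OF ser_Pow[OF X[OF A], of a]] by simp
  qed
  show "circuit_sum ser y D (insert a (insert b R)) T S = circuit_sum V y D (insert g R) T S"
    by (rule circuit_sum_cong) (use edge_replacement.unicyclic_iff[OF ser_insert[OF X] T] in simp_all)
  show "circuit_sum ser y D (insert a (insert b R)) (insert a T) S =
      circuit_sum V y D (insert g R) (insert g T) S"
    by (rule circuit_sum_cong)
      (use edge_replacement.unicyclic_Un_iff[OF ser_insert[OF X] T, of _ "{a}"] in simp_all)
  show "circuit_sum ser y D (insert a (insert b R)) (insert a (insert b T)) S =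
      circuit_sum V y D (insert g R) (insert g T) S"
    by (rule circuit_sum_cong)
      (use edge_replacement.unicyclic_Un_iff[OF ser_insert[OF X] T, of _ "{a, b}"] in simp_all)
qed

end

lemma forest_sum_upd: "x \<notin> D \<Longrightarrow> forest_sum V (y(x := t)) D R = forest_sum V y D R"
  by (rule forest_sum_cong) auto

lemma circuit_sum_upd: "x \<notin> D \<Longrightarrow> circuit_sum V (y(x := t)) D R T S = circuit_sum V y D R T S"
  by (rule circuit_sum_cong) auto

lemma square_sum_insert_upd:
  assumes "finite D" "x \<notin> D" "x \<notin> R"
  shows "square_sum V (y(x := t)) (insert x D) R =
    (\<Sum>S\<in>Pow D. prod y S * (circuit_sum V y D R R S)\<^sup>2)
    + t * (\<Sum>S\<in>Pow D. prod y S *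
        (2 * circuit_sum V y D R R S * circuit_sum V y D (insert x R) R S
          + (circuit_sum V y D (insert x R) (insert x R) S)\<^sup>2))
    + t\<^sup>2 * (\<Sum>S\<in>Pow D. prod y S * (circuit_sum V y D (insert x R) R S)\<^sup>2)"
proof -
  have w: "prod (y(x := t)) S = prod y S" if "S \<in> Pow D" for S
    using that assms(2) by (intro prod.cong) auto
  show ?thesis
    unfolding square_sum_insert[OF assms] circuit_sum_upd[OF assms(2)]
      fun_upd_same sum_distrib_left sum.distrib[symmetric]
    by (rule sum.cong) (auto simp: w power2_eq_square algebra_simps simp del: fun_upd_apply)
qed

text \<open>
  The assumption that the ring has no 2-torsion replaces absence of zero divisors: for want of a linear
  order on the indeterminates, the library does not provide the latter for polynomials over \<open>'e\<close>.
\<close>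

lemma quadratic_coeffs:
  fixes A A' :: "'r::comm_ring_1"
  assumes "\<And>r::'r. r + r = 0 \<Longrightarrow> r = 0"
    and eq: "\<And>t. A + t * B + t\<^sup>2 * C = A' + t * B' + t\<^sup>2 * C'"
  shows "A = A'" "B = B'" "C = C'"
proof -
  show A: "A = A'" using eq[of 0] by simp
  have p: "B + C = B' + C'" and m: "C - B = C' - B'"
    using eq[of 1] eq[of "-1"] A by simp_all
  have "(C - C') + (C - C') = (B + C - (B' + C')) + ((C - B) - (C' - B'))" by (simp add: algebra_simps)
  also have "\<dots> = 0" unfolding p m by simp
  finally have "C - C' = 0" by (rule assms(1))
  then show "C = C'" by simp
  then show "B = B'" using p by simp
qed

lemma quadratic_homogenize:
  fixes A :: "'r::comm_ring_1"
  assumes tf: "\<And>r::'r. r + r = 0 \<Longrightarrow> r = 0"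
    and eq: "\<And>t. (x + t * x') * (u + t * u') - (v + t * v') * (w + t * w') = A + t * B + t\<^sup>2 * C"
  shows "(s * x + p * x') * (s * u + p * u') - (s * v + p * v') * (s * w + p * w') =
    s\<^sup>2 * A + s * p * B + p\<^sup>2 * C"
proof -
  have expand: "A + t * B + t\<^sup>2 * C = (x * u - v * w) + t * (x * u' + x' * u - v * w' - v' * w)
      + t\<^sup>2 * (x' * u' - v' * w')" for t
    unfolding eq[symmetric] by (simp add: algebra_simps power2_eq_square)
  have c: "A = x * u - v * w" "B = x * u' + x' * u - v * w' - v' * w" "C = x' * u' - v' * w'"
    by (rule quadratic_coeffs[OF _ expand], erule tf)+
  show ?thesis unfolding c by (simp add: algebra_simps power2_eq_square)
qed

definition pair_identities :: "'a set set \<Rightarrow> 'a set \<Rightarrow> 'r::comm_ring_1 itself \<Rightarrow> bool" where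
  "pair_identities V E _ \<longleftrightarrow>
     (\<forall>(y :: 'a \<Rightarrow> 'r). \<forall>e\<in>E. \<forall>f\<in>E. e \<noteq> f \<longrightarrow> pair_identity V y (E - {e, f}) e f)"

definition edge_identities :: "'a set set \<Rightarrow> 'a set \<Rightarrow> 'r::comm_ring_1 itself \<Rightarrow> bool" where
  "edge_identities V E _ \<longleftrightarrow> (\<forall>(y :: 'a \<Rightarrow> 'r). \<forall>e\<in>E. edge_identity V y (E - {e}) e)"

context extension
begin

lemmas forest_sum_par_b = extension.forest_sum_par[OF commute,
  unfolded parallel_space_commute[of V E g b a] insert_commute[of b a]]
lemmas circuit_sum_par_b = extension.circuit_sum_par[OF commute,
  unfolded parallel_space_commute[of V E g b a] insert_commute[of b a]]
lemmas forest_sum_ser_b = extension.forest_sum_ser[OF commute,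
  unfolded series_space_commute[of V E g b a] insert_commute[of b a]]
lemmas circuit_sum_ser_b = extension.circuit_sum_ser[OF commute,
  unfolded series_space_commute[of V E g b a] insert_commute[of b a]]

lemma notin: "D \<subseteq> E - {g} \<Longrightarrow> a \<notin> D" "D \<subseteq> E - {g} \<Longrightarrow> b \<notin> D" "D \<subseteq> E - {g} \<Longrightarrow> g \<notin> D"
  "D \<subseteq> E - {g} \<Longrightarrow> finite D"
  using a_notin b_notin finite_E by (auto intro: finite_subset)

lemma forest_sum_par_insert2:
  assumes "D \<subseteq> E - {g}" "R \<subseteq> E - {g}"
  shows "forest_sum par y (insert a (insert b D)) R =
    forest_sum V (y(g := y a + y b)) (insert g D) R"
  using notin[OF assms(1)] a_neq_b
  by (simp add: forest_sum_insert forest_sum_upd insert_commute[of b a]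
      forest_sum_par[OF assms] forest_sum_par_b(2)[OF assms] algebra_simps)

lemma forest_sum_ser_insert2:
  assumes "D \<subseteq> E - {g}" "R \<subseteq> E - {g}"
  shows "forest_sum ser y (insert a (insert b D)) R =
    (1 + y a + y b) * forest_sum V y D R + y a * y b * forest_sum V y D (insert g R)"
  using notin[OF assms(1)] a_neq_b
  by (simp add: forest_sum_insert insert_commute[of b a]
      forest_sum_ser[OF assms] forest_sum_ser_b(2)[OF assms] algebra_simps)

lemma circuit_sum_par_eq_0:
  assumes "D \<subseteq> E - {g}" "R \<subseteq> E - {g}" "\<not> S \<union> T \<subseteq> {a, b}"
  shows "circuit_sum par y D (insert a (insert b R)) T S = 0"
  using assms(3) unfolding circuit_sum_par_insert2[OF assms(1,2)] by auto

lemma circuit_sum_par_insert2':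
  assumes "D \<subseteq> E - {g}" "R \<subseteq> E - {g}" "R \<noteq> {}"
  shows "circuit_sum par y (insert a (insert b D)) R R {} =
    circuit_sum V (y(g := y a + y b)) (insert g D) R R {}"
proof -
  have "\<not> {} \<union> R \<subseteq> {a, b}" using assms(2,3) a_notin b_notin by auto
  then show ?thesis
    using notin[OF assms(1)] a_neq_b
    by (simp add: circuit_sum_insert circuit_sum_upd insert_commute[of b a]
        circuit_sum_par[OF assms(1,2,2)] circuit_sum_par_b(2)[OF assms(1,2,2)]
        circuit_sum_par_eq_0[OF assms(1,2)] algebra_simps)
qed

lemma circuit_sum_ser_insert2:
  assumes "D \<subseteq> E - {g}" "R \<subseteq> E - {g}"
  shows "circuit_sum ser y (insert a (insert b D)) R R {} =
    (1 + y a + y b) * circuit_sum V y D R R {} + y a * y b * circuit_sum V y D (insert g R) R {}"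
  using notin[OF assms(1)] a_neq_b
  by (simp add: circuit_sum_insert insert_commute[of b a]
      circuit_sum_ser[OF assms(1,2,2)] circuit_sum_ser_b(2)[OF assms(1,2,2)] algebra_simps)

lemma square_sum_par_insert2:
  assumes "D \<subseteq> E - {g}" "R \<subseteq> E - {g}" "R \<noteq> {}"
  shows "square_sum par y (insert a (insert b D)) R =
    square_sum V (y(g := y a + y b)) (insert g D) R"
proof -
  have z: "\<not> S \<union> T \<subseteq> {a, b}" if "R \<subseteq> T" for S T using that assms(2,3) a_notin b_notin by auto
  have R: "a \<notin> R" "b \<notin> R" "g \<notin> R" using notin[OF assms(2)] by auto
  have za: "circuit_sum par y D (insert a (insert b R)) T S = 0" if "R \<subseteq> T" for S T
    by (rule circuit_sum_par_eq_0[OF assms(1,2) z[OF that]])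
  note D = notin[OF assms(1)]
  show ?thesis
    unfolding square_sum_insert2[OF D(4,1,2) a_neq_b R(1,2)] square_sum_insert_upd[OF D(4,3) R(3)]
      sum_distrib_left sum.distrib[symmetric]
    by (rule sum.cong)
      (simp_all add: za circuit_sum_par[OF assms(1,2,2)] circuit_sum_par_b(2,3)[OF assms(1,2,2)]
        subset_insertI2 power2_eq_square algebra_simps)
qed

lemma square_sum_ser_insert2:
  assumes "D \<subseteq> E - {g}" "R \<subseteq> E - {g}"
  shows "square_sum ser y (insert a (insert b D)) R =
    (1 + y a + y b)\<^sup>2 * (\<Sum>S\<in>Pow D. prod y S * (circuit_sum V y D R R S)\<^sup>2)
    + (1 + y a + y b) * (y a * y b) * (\<Sum>S\<in>Pow D. prod y S *
        (2 * circuit_sum V y D R R S * circuit_sum V y D (insert g R) R S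
          + (circuit_sum V y D (insert g R) (insert g R) S)\<^sup>2))
    + (y a * y b)\<^sup>2 * (\<Sum>S\<in>Pow D. prod y S * (circuit_sum V y D (insert g R) R S)\<^sup>2)"
proof -
  have R: "a \<notin> R" "b \<notin> R" "g \<notin> R" using notin[OF assms(2)] by auto
  note D = notin[OF assms(1)]
  show ?thesis
    unfolding square_sum_insert2[OF D(4,1,2) a_neq_b R(1,2)]
      sum_distrib_left sum.distrib[symmetric]
    by (rule sum.cong)
      (simp_all add: circuit_sum_ser[OF assms(1,2,2)] circuit_sum_ser_b(2,3,5)[OF assms(1,2,2)]
        insert_commute[of b a] power2_eq_square algebra_simps)
qed

lemma pair_identity_par:
  assumes "pair_identity V (y(g := y a + y b)) (E - {e, f}) e f" "e \<in> E - {g}" "f \<in> E - {g}"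
  shows "pair_identity par y (insert a (insert b (E - {g})) - {e, f}) e f"
proof -
  define D where "D = E - {g, e, f}"
  have D: "D \<subseteq> E - {g}" unfolding D_def by auto
  have E: "E - {e, f} = insert g D" "insert a (insert b (E - {g})) - {e, f} = insert a (insert b D)"
    unfolding D_def using assms(2,3) g_in a_notin b_notin by auto
  show ?thesis
    using assms unfolding pair_identity_def E
    by (simp add: forest_sum_par_insert2[OF D] square_sum_par_insert2[OF D])
qed

lemma edge_identity_par:
  assumes "edge_identity V (y(g := y a + y b)) (E - {e}) e" "e \<in> E - {g}"
  shows "edge_identity par y (insert a (insert b (E - {g})) - {e}) e"
proof -
  define D where "D = E - {g, e}"
  have D: "D \<subseteq> E - {g}" unfolding D_def by auto
  have E: "E - {e} = insert g D" "insert a (insert b (E - {g})) - {e} = insert a (insert b D)"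
    unfolding D_def using assms(2) g_in a_notin b_notin by auto
  show ?thesis
    using assms unfolding edge_identity_def E
    by (simp add: forest_sum_par_insert2[OF D] circuit_sum_par_insert2'[OF D]
        square_sum_par_insert2[OF D])
qed

lemma pair_identity_par_a:
  assumes "pair_identity V y (E - {g, f}) g f" "f \<in> E - {g}"
  shows "pair_identity par y (insert a (insert b (E - {g})) - {a, f}) a f"
proof -
  define D where "D = E - {g, f}"
  have D: "D \<subseteq> E - {g}" unfolding D_def by auto
  have E: "insert a (insert b (E - {g})) - {a, f} = insert b D"
    unfolding D_def using assms(2) a_notin b_notin a_neq_b by auto
  have f: "{f} \<subseteq> E - {g}" "f \<noteq> a" "f \<noteq> b" using assms(2) a_notin b_notin by auto
  have z: "circuit_sum par y D {a, b, f} T S = 0" if "f \<in> T" for S T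
    by (rule circuit_sum_par_eq_0[OF D f(1)]) (use that f in auto)
  have "b \<notin> {a, f}" using f a_neq_b by auto
  note sq = square_sum_insert[OF notin(4,2)[OF D] this]
  have "square_sum par y (insert b D) {a, f} = square_sum V y D {g, f}"
    unfolding sq unfolding square_sum_def
    by (rule sum.cong) (simp_all add: z insert_commute[of b a] circuit_sum_par[OF D f(1) f(1)])
  then show ?thesis
    using assms(1) notin[OF D] unfolding pair_identity_def E D_def[symmetric]
    by (simp add: forest_sum_insert insert_commute[of b a]
        forest_sum_par[OF D f(1)] forest_sum_par_b(2)[OF D f(1)]
        forest_sum_par[OF D empty_subsetI] forest_sum_par_b(2)[OF D empty_subsetI] algebra_simps)
qed

lemma pair_identity_ser:
  assumes "\<And>y :: 'a \<Rightarrow> 'r::comm_ring_1. pair_identity V y (E - {e, f}) e f"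
    and "e \<in> E - {g}" "f \<in> E - {g}" and tf: "\<And>r::'r. r + r = 0 \<Longrightarrow> r = 0"
  shows "pair_identity ser (y :: 'a \<Rightarrow> 'r) (insert a (insert b (E - {g})) - {e, f}) e f"
proof -
  define D where "D = E - {g, e, f}"
  have D: "D \<subseteq> E - {g}" unfolding D_def by auto
  have E: "E - {e, f} = insert g D" "insert a (insert b (E - {g})) - {e, f} = insert a (insert b D)"
    unfolding D_def using assms(2,3) g_in a_notin b_notin by auto
  have R: "{} \<subseteq> E - {g}" "{e} \<subseteq> E - {g}" "{f} \<subseteq> E - {g}" "{e, f} \<subseteq> E - {g}"
    using assms(2,3) by auto
  have g: "g \<notin> {e, f}" using assms(2,3) by auto
  note id = assms(1)[unfolded pair_identity_def E, of "y(g := t)" for t,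
      unfolded square_sum_insert_upd[OF notin(4,3)[OF D] g]
        forest_sum_insert[OF notin(4,3)[OF D]] forest_sum_upd[OF notin(3)[OF D]] fun_upd_same]
  show ?thesis
    unfolding pair_identity_def E square_sum_ser_insert2[OF D R(4)]
      R(1-3)[THEN forest_sum_ser_insert2[OF D]] forest_sum_ser_insert2[OF D R(4)]
    using tf id by (rule quadratic_homogenize)
qed

lemma edge_identity_ser:
  assumes "\<And>y :: 'a \<Rightarrow> 'r::comm_ring_1. edge_identity V y (E - {e}) e"
    and "e \<in> E - {g}" and tf: "\<And>r::'r. r + r = 0 \<Longrightarrow> r = 0"
  shows "edge_identity ser (y :: 'a \<Rightarrow> 'r) (insert a (insert b (E - {g})) - {e}) e"
proof -
  define D where "D = E - {g, e}"
  have D: "D \<subseteq> E - {g}" unfolding D_def by auto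
  have E: "E - {e} = insert g D" "insert a (insert b (E - {g})) - {e} = insert a (insert b D)"
    unfolding D_def using assms(2) g_in a_notin b_notin by auto
  have R: "{} \<subseteq> E - {g}" "{e} \<subseteq> E - {g}" "g \<notin> {e}"
    using assms(2) by auto
  note id = assms(1)[unfolded edge_identity_def E, of "y(g := t)" for t,
      unfolded square_sum_insert_upd[OF notin(4,3)[OF D] R(3)]
        forest_sum_insert[OF notin(4,3)[OF D]] forest_sum_upd[OF notin(3)[OF D]] fun_upd_same
        circuit_sum_insert[OF notin(4,3)[OF D] empty_subsetI] circuit_sum_upd[OF notin(3)[OF D]]]
  show ?thesis
    unfolding edge_identity_def E square_sum_ser_insert2[OF D R(2)]
      forest_sum_ser_insert2[OF D R(1)] circuit_sum_ser_insert2[OF D R(2)]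
    by (rule quadratic_homogenize[where v = 0 and v' = 0 and w = 0 and w' = 0, simplified])
      (use tf id in simp_all)
qed

lemma square_sum_ser_a:
  assumes "D \<subseteq> E - {g}" "R \<subseteq> E - {g}"
  shows "square_sum ser y (insert b D) (insert a R) =
    y b * (1 + y b) * square_sum V y D (insert g R)"
proof -
  have "b \<notin> insert a R" using assms(2) b_notin a_neq_b by auto
  note sq = square_sum_insert[OF notin(4,2)[OF assms(1)] this]
  show ?thesis
    unfolding sq unfolding square_sum_def sum_distrib_left
    by (rule sum.cong)
      (simp_all add: insert_commute[of b a] circuit_sum_ser[OF assms(1,2,2)] algebra_simps
        power2_eq_square)
qed

lemma pair_identity_ser_a:
  assumes "pair_identity V y (E - {g, f}) g f" "f \<in> E - {g}"
  shows "pair_identity ser y (insert a (insert b (E - {g})) - {a, f}) a f"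
proof -
  define D where "D = E - {g, f}"
  have D: "D \<subseteq> E - {g}" unfolding D_def by auto
  have E: "insert a (insert b (E - {g})) - {a, f} = insert b D"
    unfolding D_def using assms(2) a_notin b_notin a_neq_b by auto
  have f: "{f} \<subseteq> E - {g}" "{} \<subseteq> E - {g}" using assms(2) by auto
  have eq: "(x + t * u) * (v + t * v) - (x + t * x) * (v + t * w) = t * (1 + t) * (u * v - x * w)"
    for x t u v w :: 'b by (simp add: algebra_simps)
  have id: "forest_sum V y D {g} * forest_sum V y D {f} - forest_sum V y D {} * forest_sum V y D {g, f}
      = square_sum V y D {g, f}"
    using assms(1) unfolding pair_identity_def D_def[symmetric] .
  show ?thesis
    unfolding pair_identity_def E square_sum_ser_a[OF D f(1)] id[symmetric] eq[symmetric]
    using notin[OF D]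
    by (simp add: forest_sum_insert insert_commute[of b a] f[THEN forest_sum_ser(1)[OF D]]
      f[THEN forest_sum_ser(2)[OF D]] f[THEN forest_sum_ser(3)[OF D]] f[THEN forest_sum_ser_b(2)[OF D]])
qed

lemma edge_identity_ser_a:
  assumes "edge_identity V y (E - {g}) g"
  shows "edge_identity ser y (insert a (insert b (E - {g})) - {a}) a"
proof -
  define D where "D = E - {g}"
  have D: "D \<subseteq> E - {g}" unfolding D_def by auto
  have E: "insert a (insert b (E - {g})) - {a} = insert b D"
    unfolding D_def using a_notin b_notin a_neq_b by auto
  have id: "circuit_sum V y D {g} {g} {} * forest_sum V y D {} = square_sum V y D {g}"
    using assms(1) unfolding edge_identity_def D_def[symmetric] .
  show ?thesis
    unfolding edge_identity_def E square_sum_ser_a[OF D empty_subsetI] id[symmetric]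
    using notin[OF D]
    by (simp add: forest_sum_insert circuit_sum_insert insert_commute[of b a]
        forest_sum_ser[OF D empty_subsetI] forest_sum_ser_b(2)[OF D empty_subsetI]
        circuit_sum_ser[OF D empty_subsetI empty_subsetI empty_subsetI] algebra_simps)
qed

lemma pair_identity_par_ab: "pair_identity par y (insert a (insert b (E - {g})) - {a, b}) a b"
proof -
  define D where "D = E - {g}"
  have D: "D \<subseteq> E - {g}" unfolding D_def by auto
  have E: "insert a (insert b (E - {g})) - {a, b} = D"
    unfolding D_def using a_notin b_notin by auto
  have "circuit_sum par y D {a, b} {a, b} S = of_bool (S = {}) * forest_sum V y D {g}"
    if "S \<subseteq> D" for S
  proof -
    have iff: "S \<union> {a, b} \<subseteq> {a, b} \<longleftrightarrow> S = {}" using that notin[OF D] by auto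
    then show ?thesis
      unfolding circuit_sum_par_insert2[OF D empty_subsetI] forest_sum_def iff by (cases "S = {}") simp_all
  qed
  then have "square_sum par y D {a, b} =
      (\<Sum>S\<in>Pow D. if S = {} then (forest_sum V y D {g})\<^sup>2 else 0)"
    unfolding square_sum_def by (intro sum.cong) simp_all
  also have "\<dots> = (forest_sum V y D {g})\<^sup>2" using notin(4)[OF D] by (simp add: sum.delta)
  finally show ?thesis
    unfolding pair_identity_def E
    by (simp add: forest_sum_par[OF D empty_subsetI] forest_sum_par_b(2)[OF D empty_subsetI]
        power2_eq_square)
qed

lemma pair_identity_ser_ab:
  assumes "edge_identity V y (E - {g}) g"
  shows "pair_identity ser y (insert a (insert b (E - {g})) - {a, b}) a b"
proof -
  define D where "D = E - {g}"
  have D: "D \<subseteq> E - {g}" unfolding D_def by auto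
  have E: "insert a (insert b (E - {g})) - {a, b} = D"
    unfolding D_def using a_notin b_notin by auto
  have id: "circuit_sum V y D {g} {g} {} * forest_sum V y D {} = square_sum V y D {g}"
    using assms(1) unfolding edge_identity_def D_def[symmetric] .
  have "square_sum ser y D {a, b} = square_sum V y D {g}"
    unfolding square_sum_def
    by (rule sum.cong) (simp_all add: circuit_sum_ser[OF D empty_subsetI empty_subsetI])
  then show ?thesis
    unfolding pair_identity_def E id[symmetric]
    by (simp add: forest_sum_ser[OF D empty_subsetI] forest_sum_ser_b(2)[OF D empty_subsetI]
        forest_sum_split[OF sym_diff_closed notin(3)[OF D]] algebra_simps)
qed

lemma edge_identity_par_a:
  assumes "edge_identity V y (E - {g}) g"
  shows "edge_identity par y (insert a (insert b (E - {g})) - {a}) a"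
proof -
  define D where "D = E - {g}"
  have D: "D \<subseteq> E - {g}" unfolding D_def by auto
  have E: "insert a (insert b (E - {g})) - {a} = insert b D"
    unfolding D_def using a_notin b_notin a_neq_b by auto
  have id: "circuit_sum V y D {g} {g} {} * forest_sum V y D {} = square_sum V y D {g}"
    using assms(1) unfolding edge_identity_def D_def[symmetric] .
  define c where "c S = circuit_sum V y D {g} {g} S" for S
  define z where "z = forest_sum V y D {g}"
  have Z: "forest_sum V y D {} = c {} + z"
    unfolding c_def z_def by (rule forest_sum_split[OF sym_diff_closed notin(3)[OF D]])
  have ab: "circuit_sum par y D {a, b} T S = of_bool (S = {}) * z"
    if "S \<subseteq> D" "T \<subseteq> {a, b}" for S T
  proof -
    have iff: "S \<union> T \<subseteq> {a, b} \<longleftrightarrow> S = {}" using that notin[OF D] by auto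
    then show ?thesis
      unfolding circuit_sum_par_insert2[OF D empty_subsetI] forest_sum_def z_def iff
      by (cases "S = {}") simp_all
  qed
  have "b \<notin> {a}" using a_neq_b by simp
  note sq = square_sum_insert[OF notin(4,2)[OF D] this]
  have "square_sum par y (insert b D) {a} = (\<Sum>S\<in>Pow D. prod y S * (c S)\<^sup>2
      + (if S = {} then 2 * (y b * c {} * z) + (y b * z)\<^sup>2 + y b * z\<^sup>2 else 0))"
    unfolding sq
    by (rule sum.cong)
      (auto simp: ab insert_commute[of b a] circuit_sum_par[OF D empty_subsetI empty_subsetI]
        c_def[symmetric] power2_eq_square algebra_simps)
  also have "\<dots> = square_sum V y D {g} + 2 * (y b * c {} * z) + (y b * z)\<^sup>2 + y b * z\<^sup>2"
    using notin(4)[OF D] unfolding square_sum_def c_def[symmetric]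
    by (simp add: sum.distrib sum.delta)
  finally show ?thesis
    unfolding edge_identity_def E id[symmetric] Z
    using notin[OF D]
    by (simp add: forest_sum_insert circuit_sum_insert insert_commute[of b a]
        forest_sum_par[OF D empty_subsetI] forest_sum_par_b(2)[OF D empty_subsetI]
        circuit_sum_par[OF D empty_subsetI empty_subsetI empty_subsetI]
        ab Z c_def[symmetric] z_def[symmetric] power2_eq_square algebra_simps)
qed

lemma insert2_cases:
  assumes "e \<in> insert a (insert b (E - {g}))"
  obtains "e = a" | "e = b" | "e \<in> E - {g}"
  using assms by blast

lemma edge_identities_par:
  assumes "edge_identities V E TYPE('r::comm_ring_1)"
  shows "edge_identities par (insert a (insert b (E - {g}))) TYPE('r)"
  unfolding edge_identities_def
proof (intro allI ballI)
  fix y :: "'a \<Rightarrow> 'r" and e assume e: "e \<in> insert a (insert b (E - {g}))"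
  have id: "edge_identity V y (E - {e}) e" if "e \<in> E" for y :: "'a \<Rightarrow> 'r" and e
    using assms that unfolding edge_identities_def by simp
  note E = insert_commute[of b a "E - {g}"]
  from e show "edge_identity par y (insert a (insert b (E - {g})) - {e}) e"
  proof (cases rule: insert2_cases)
    case 1
    then show ?thesis using edge_identity_par_a[OF id[OF g_in]] by simp
  next
    case 2
    then show ?thesis
      using extension.edge_identity_par_a[OF commute id[OF g_in], of y]
      unfolding E parallel_space_commute[of V E g b a] by simp
  next
    case 3
    then show ?thesis by (intro edge_identity_par id) simp_all
  qed
qed

lemma edge_identities_ser:
  assumes "edge_identities V E TYPE('r::comm_ring_1)" and tf: "\<And>r::'r. r + r = 0 \<Longrightarrow> r = 0"
  shows "edge_identities ser (insert a (insert b (E - {g}))) TYPE('r)"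
  unfolding edge_identities_def
proof (intro allI ballI)
  fix y :: "'a \<Rightarrow> 'r" and e assume e: "e \<in> insert a (insert b (E - {g}))"
  have id: "edge_identity V y (E - {e}) e" if "e \<in> E" for y :: "'a \<Rightarrow> 'r" and e
    using assms(1) that unfolding edge_identities_def by simp
  note E = insert_commute[of b a "E - {g}"]
  from e show "edge_identity ser y (insert a (insert b (E - {g})) - {e}) e"
  proof (cases rule: insert2_cases)
    case 1
    then show ?thesis using edge_identity_ser_a[OF id[OF g_in]] by simp
  next
    case 2
    then show ?thesis
      using extension.edge_identity_ser_a[OF commute id[OF g_in], of y]
      unfolding E series_space_commute[of V E g b a] by simp
  next
    case 3
    show ?thesis by (rule edge_identity_ser[OF id _ tf]) (use 3 in simp_all)
  qed
qed

lemma pair_identities_par: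
  assumes "pair_identities V E TYPE('r::comm_ring_1)"
  shows "pair_identities par (insert a (insert b (E - {g}))) TYPE('r)"
  unfolding pair_identities_def
proof (intro allI ballI impI)
  let ?E = "insert a (insert b (E - {g}))"
  fix y :: "'a \<Rightarrow> 'r" and e f assume e: "e \<in> ?E" and f: "f \<in> ?E" and "e \<noteq> f"
  have id: "pair_identity V y (E - {e, f}) e f" if "e \<in> E" "f \<in> E" "e \<noteq> f"
    for y :: "'a \<Rightarrow> 'r" and e f
    using assms(1) that unfolding pair_identities_def by simp
  note E = insert_commute[of b a "E - {g}"]
  have a: "pair_identity par y (?E - {a, f}) a f" if "f \<in> E - {g}" for f
    using that g_in by (intro pair_identity_par_a id) auto
  have b: "pair_identity par y (?E - {b, f}) b f" if "f \<in> E - {g}" for f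
    using extension.pair_identity_par_a[OF commute id that, of y] that g_in
    unfolding E parallel_space_commute[of V E g b a] by auto
  have sym: "pair_identity par y (?E - {e, f}) e f" if "pair_identity par y (?E - {f, e}) f e" for e f
    using that by (simp only: pair_identity_commute[of par y _ e f] insert_commute[of e f "{}"])
  from e show "pair_identity par y (?E - {e, f}) e f"
  proof (cases rule: insert2_cases)
    case 1
    from f show ?thesis
      by (cases rule: insert2_cases) (use 1 \<open>e \<noteq> f\<close> a pair_identity_par_ab in simp_all)
  next
    case 2
    from f show ?thesis
      by (cases rule: insert2_cases) (use 2 \<open>e \<noteq> f\<close> b sym[OF pair_identity_par_ab] in simp_all)
  next
    case 3
    from f show ?thesis
    proof (cases rule: insert2_cases)
      case 1
      show ?thesis unfolding 1 by (rule sym[OF a[OF 3]])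
    next
      case 2
      show ?thesis unfolding 2 by (rule sym[OF b[OF 3]])
    next
      case f: 3
      show ?thesis by (intro pair_identity_par id) (use 3 f \<open>e \<noteq> f\<close> in simp_all)
    qed
  qed
qed

lemma pair_identities_ser:
  assumes "pair_identities V E TYPE('r::comm_ring_1)" "edge_identities V E TYPE('r)"
    and tf: "\<And>r::'r. r + r = 0 \<Longrightarrow> r = 0"
  shows "pair_identities ser (insert a (insert b (E - {g}))) TYPE('r)"
  unfolding pair_identities_def
proof (intro allI ballI impI)
  let ?E = "insert a (insert b (E - {g}))"
  fix y :: "'a \<Rightarrow> 'r" and e f assume e: "e \<in> ?E" and f: "f \<in> ?E" and "e \<noteq> f"
  have id: "pair_identity V y (E - {e, f}) e f" if "e \<in> E" "f \<in> E" "e \<noteq> f"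
    for y :: "'a \<Rightarrow> 'r" and e f
    using assms(1) that unfolding pair_identities_def by simp
  note E = insert_commute[of b a "E - {g}"]
  have a: "pair_identity ser y (?E - {a, f}) a f" if "f \<in> E - {g}" for f
    using that g_in by (intro pair_identity_ser_a id) auto
  have b: "pair_identity ser y (?E - {b, f}) b f" if "f \<in> E - {g}" for f
    using extension.pair_identity_ser_a[OF commute id that, of y] that g_in
    unfolding E series_space_commute[of V E g b a] by auto
  have "edge_identity V y (E - {g}) g"
    using assms(2) g_in unfolding edge_identities_def by simp
  note ab = pair_identity_ser_ab[OF this]
  have sym: "pair_identity ser y (?E - {e, f}) e f" if "pair_identity ser y (?E - {f, e}) f e" for e f
    using that by (simp only: pair_identity_commute[of ser y _ e f] insert_commute[of e f "{}"])
  from e show "pair_identity ser y (?E - {e, f}) e f"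
  proof (cases rule: insert2_cases)
    case 1
    from f show ?thesis
      by (cases rule: insert2_cases) (use 1 \<open>e \<noteq> f\<close> a ab in simp_all)
  next
    case 2
    from f show ?thesis
      by (cases rule: insert2_cases) (use 2 \<open>e \<noteq> f\<close> b sym[OF ab] in simp_all)
  next
    case 3
    from f show ?thesis
    proof (cases rule: insert2_cases)
      case 1
      show ?thesis unfolding 1 by (rule sym[OF a[OF 3]])
    next
      case 2
      show ?thesis unfolding 2 by (rule sym[OF b[OF 3]])
    next
      case f: 3
      show ?thesis
        by (rule pair_identity_ser[OF id _ _ tf]) (use 3 f \<open>e \<noteq> f\<close> in simp_all)
    qed
  qed
qed

end

section \<open>Minors and isomorphisms\<close>

lemma pair_identities_restrict:
  assumes "pair_identities V E TYPE('r::comm_ring_1)" "finite E" "E' \<subseteq> E"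
  shows "pair_identities (V \<inter> Pow E') E' TYPE('r)"
  unfolding pair_identities_def
proof (intro allI ballI impI)
  fix y :: "'a \<Rightarrow> 'r" and e f assume e: "e \<in> E'" and f: "f \<in> E'" and neq: "e \<noteq> f"
  define z where "z x = (if x \<in> E' then y x else 0)" for x
  define D where "D = E - {e, f}"
  define D' where "D' = E' - {e, f}"
  have sub: "D' \<subseteq> D" "finite D" using assms(2,3) unfolding D_def D'_def by auto
  have z0: "prod z X = 0" if X: "X \<in> Pow D - Pow D'" for X
  proof -
    obtain x where "x \<in> X" "x \<notin> E'" using X unfolding D_def D'_def by blast
    moreover have "finite X" using that sub by (auto intro: finite_subset)
    ultimately show ?thesis unfolding z_def by (intro prod_zero) auto
  qed
  have zy: "prod z X = prod y X" if "X \<subseteq> E'" for X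
    using that unfolding z_def by (intro prod.cong) auto
  have ind: "indep (V \<inter> Pow E') X \<longleftrightarrow> indep V X" if "X \<subseteq> E'" for X
    using that by (intro indep_cong) auto
  have uni: "unicyclic (V \<inter> Pow E') X T \<longleftrightarrow> unicyclic V X T" if "X \<subseteq> E'" for X T
    using that by (intro unicyclic_cong) auto
  have D'E: "D' \<subseteq> E'" unfolding D'_def by auto
  have F: "forest_sum V z D R = forest_sum (V \<inter> Pow E') y D' R" if "R \<subseteq> E'" for R
    unfolding forest_sum_def
    by (rule sum.mono_neutral_cong_right)
      (use sub z0 that D'E in \<open>auto simp: zy ind\<close>)
  have C: "circuit_sum V z D {e, f} {e, f} S = circuit_sum (V \<inter> Pow E') y D' {e, f} {e, f} S"
    if "S \<subseteq> D'" for S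
    unfolding circuit_sum_def
  proof (rule sum.mono_neutral_cong_right)
    show "\<forall>A\<in>Pow D - Pow D'. of_bool (unicyclic V (A \<union> {e, f}) (S \<union> {e, f})) * prod z (A - S) = 0"
    proof
      fix A assume "A \<in> Pow D - Pow D'"
      then have "A - S \<in> Pow D - Pow D'" using that by auto
      then show "of_bool (unicyclic V (A \<union> {e, f}) (S \<union> {e, f})) * prod z (A - S) = 0"
        using z0 by simp
    qed
    fix A assume A: "A \<in> Pow D'"
    have "A \<union> {e, f} \<subseteq> E'" "A - S \<subseteq> E'" using A D'E e f by auto
    then show "of_bool (unicyclic V (A \<union> {e, f}) (S \<union> {e, f})) * prod z (A - S) =
        of_bool (unicyclic (V \<inter> Pow E') (A \<union> {e, f}) (S \<union> {e, f})) * prod y (A - S)"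
      by (simp only: zy uni)
  qed (use sub in auto)
  have S: "square_sum V z D {e, f} = square_sum (V \<inter> Pow E') y D' {e, f}"
    unfolding square_sum_def
    by (rule sum.mono_neutral_cong_right)
      (use sub z0 D'E in \<open>auto simp: zy C\<close>)
  have "pair_identity V z D e f"
    using assms(1,3) e f neq unfolding pair_identities_def D_def by auto
  then show "pair_identity (V \<inter> Pow E') y (E' - {e, f}) e f"
    unfolding pair_identity_def D'_def[symmetric] S using e f by (simp add: F)
qed

lemma pair_identities_contract:
  assumes "pair_identities V E TYPE('r::comm_ring_1)" and tf: "\<And>r::'r. r + r = 0 \<Longrightarrow> r = 0"
    and "finite E" "sym_diff_closed V" "x \<in> E" "{x} \<notin> V"
  shows "pair_identities ((\<lambda>C. C - {x}) ` V) (E - {x}) TYPE('r)"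
  unfolding pair_identities_def
proof (intro allI ballI impI)
  let ?V = "(\<lambda>C. C - {x}) ` V"
  fix y :: "'a \<Rightarrow> 'r" and e f assume e: "e \<in> E - {x}" and f: "f \<in> E - {x}" and neq: "e \<noteq> f"
  define D where "D = E - {x} - {e, f}"
  have E: "E - {e, f} = insert x D" using e f assms(5) unfolding D_def by auto
  have D: "finite D" "x \<notin> D" using assms(3) unfolding D_def by auto
  have inj: "inj_on (\<lambda>C. C - {x}) V"
  proof (rule inj_onI)
    fix A B assume AB: "A \<in> V" "B \<in> V" "A - {x} = B - {x}"
    have "sym_diff A B \<in> V" using AB(1,2) assms(4) unfolding sym_diff_closed_def by simp
    moreover have "sym_diff A B \<subseteq> {x}" using AB(3) by auto
    ultimately have "sym_diff A B = {}" using assms(6) subset_singletonD by metis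
    then show "A = B" by auto
  qed
  have empty: "C - {x} = {} \<longleftrightarrow> C = {}" if "C \<in> V" for C
    using that assms(6) subset_singletonD[of C x] by auto
  have sp: "?V \<inter> Pow X = (\<lambda>C. C - {x}) ` (V \<inter> Pow (insert x X))" if "x \<notin> X" for X
    using that by auto
  have ind: "indep ?V X \<longleftrightarrow> indep V (insert x X)" if "x \<notin> X" for X
    using sp[OF that] empty by (rule indep_transfer)
  have uni: "unicyclic ?V X T \<longleftrightarrow> unicyclic V (insert x X) T" if "x \<notin> X" "x \<notin> T" for X T
  proof (rule unicyclic_transfer[OF sp[OF that(1)] _ empty])
    show "inj_on (\<lambda>C. C - {x}) (V \<inter> Pow (insert x X))" using inj by (rule inj_on_subset) simp
  qed (use that in auto)
  have F: "forest_sum ?V y D R = forest_sum V y D (insert x R)" if "x \<notin> R" for R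
  proof (rule forest_sum_cong)
    fix X assume "X \<subseteq> D"
    then have "x \<notin> X \<union> R" using that D(2) by auto
    then show "indep ?V (X \<union> R) = indep V (X \<union> insert x R)" using ind by simp
  qed simp
  have C: "circuit_sum ?V y D {e, f} {e, f} S = circuit_sum V y D (insert x {e, f}) {e, f} S"
    if "S \<subseteq> D" for S
  proof (rule circuit_sum_cong)
    fix A assume "A \<subseteq> D"
    then have "x \<notin> A \<union> {e, f}" "x \<notin> S \<union> {e, f}" using D that e f by auto
    then show "unicyclic ?V (A \<union> {e, f}) (S \<union> {e, f}) =
        unicyclic V (A \<union> insert x {e, f}) (S \<union> {e, f})"
      using uni by simp
  qed auto
  have S: "square_sum ?V y D {e, f} =
      (\<Sum>S\<in>Pow D. prod y S * (circuit_sum V y D (insert x {e, f}) {e, f} S)\<^sup>2)"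
    unfolding square_sum_def by (rule sum.cong) (simp_all add: C)
  have x: "x \<notin> {e, f}" using e f by auto
  have id: "pair_identity V (y(x := t)) (insert x D) e f" for t
    using assms(1) e f neq unfolding pair_identities_def E[symmetric] by simp
  note id' = id[unfolded pair_identity_def square_sum_insert_upd[OF D x]
      forest_sum_insert[OF D] forest_sum_upd[OF D(2)] fun_upd_same]
  have expand: "(a + t * a') * (b + t * b') - (c + t * c') * (d + t * d') =
      (a * b - c * d) + t * (a * b' + a' * b - c * d' - c' * d) + t\<^sup>2 * (a' * b' - c' * d')"
    for a a' b b' c c' d d' t :: 'r by (simp add: algebra_simps power2_eq_square)
  show "pair_identity ?V y (E - {x} - {e, f}) e f"
    unfolding pair_identity_def D_def[symmetric] S
    using quadratic_coeffs(3)[OF _ id'[unfolded expand]] tf x by (simp add: F)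
qed

lemma pair_identities_image:
  fixes V :: "'a set set" and \<psi> :: "'a \<Rightarrow> 'b"
  assumes "pair_identities (image \<psi> ` V) (\<psi> ` E) TYPE('r::comm_ring_1)" "inj_on \<psi> E" "V \<subseteq> Pow E"
  shows "pair_identities V E TYPE('r)"
  unfolding pair_identities_def
proof (intro allI ballI impI)
  let ?V = "image \<psi> ` V"
  fix y :: "'a \<Rightarrow> 'r" and e f assume e: "e \<in> E" and f: "f \<in> E" and neq: "e \<noteq> f"
  define z where "z = y \<circ> inv_into E \<psi>"
  define D where "D = E - {e, f}"
  have D: "D \<subseteq> E" unfolding D_def by auto
  have img: "\<psi> ` E - {\<psi> e, \<psi> f} = \<psi> ` D"
    using e f assms(2) unfolding D_def by (auto simp: inj_on_def)
  have w: "prod z (\<psi> ` X) = prod y X" if "X \<subseteq> E" for X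
  proof -
    have "prod z (\<psi> ` X) = (\<Prod>x\<in>X. z (\<psi> x))"
      using inj_on_subset[OF assms(2) that] by (simp add: prod.reindex)
    also have "\<dots> = prod y X"
      using that assms(2) unfolding z_def by (intro prod.cong) auto
    finally show ?thesis .
  qed
  have inj: "inj_on (image \<psi>) (Pow E)" using assms(2) by (rule inj_on_image_Pow)
  have sub_iff: "\<psi> ` X \<subseteq> \<psi> ` Y \<longleftrightarrow> X \<subseteq> Y" if "X \<subseteq> E" "Y \<subseteq> E" for X Y
    using inj_on_image_mem_iff[OF assms(2)] that by blast
  have sp: "?V \<inter> Pow (\<psi> ` X) = image \<psi> ` (V \<inter> Pow X)" if "X \<subseteq> E" for X
    using assms(3) sub_iff[OF _ that] by auto
  have ind: "indep ?V (\<psi> ` X) \<longleftrightarrow> indep V X" if "X \<subseteq> E" for X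
    using sp[OF that] by (rule indep_transfer) simp
  have uni: "unicyclic ?V (\<psi> ` X) (\<psi> ` T) \<longleftrightarrow> unicyclic V X T" if "X \<subseteq> E" "T \<subseteq> E" for X T
  proof (rule unicyclic_transfer[OF sp[OF that(1)]])
    show "inj_on (image \<psi>) (V \<inter> Pow X)" using inj by (rule inj_on_subset) (use that in auto)
    show "\<psi> ` T \<subseteq> \<psi> ` C \<longleftrightarrow> T \<subseteq> C" if "C \<in> V" for C
      using sub_iff \<open>T \<subseteq> E\<close> that assms(3) by blast
  qed simp
  have injD: "inj_on (image \<psi>) (Pow D)" using inj by (rule inj_on_subset) (use D in auto)
  have reindex: "sum h (Pow (\<psi> ` D)) = (\<Sum>X\<in>Pow D. h (\<psi> ` X))" for h :: "'b set \<Rightarrow> 'r"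
    unfolding image_Pow_surj[OF HOL.refl, symmetric] by (simp add: sum.reindex[OF injD])
  have F: "forest_sum ?V z (\<psi> ` D) (\<psi> ` R) = forest_sum V y D R" if "R \<subseteq> E" for R
    unfolding forest_sum_def reindex
  proof (rule sum.cong)
    fix X assume X: "X \<in> Pow D"
    have "X \<union> R \<subseteq> E" "X \<subseteq> E" using X D that by auto
    then show "of_bool (indep ?V (\<psi> ` X \<union> \<psi> ` R)) * prod z (\<psi> ` X) =
        of_bool (indep V (X \<union> R)) * prod y X"
      unfolding image_Un[symmetric] by (simp only: ind w)
  qed simp
  have C: "circuit_sum ?V z (\<psi> ` D) (\<psi> ` R) (\<psi> ` R) (\<psi> ` S) = circuit_sum V y D R R S"
    if "R \<subseteq> E" "S \<subseteq> D" for R S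
    unfolding circuit_sum_def reindex
  proof (rule sum.cong)
    fix A assume A: "A \<in> Pow D"
    have sub: "A \<union> R \<subseteq> E" "S \<union> R \<subseteq> E" "A - S \<subseteq> E" using A D that by auto
    have diff: "\<psi> ` A - \<psi> ` S = \<psi> ` (A - S)"
      using inj_on_image_set_diff[OF assms(2), of A S] A D that by auto
    show "of_bool (unicyclic ?V (\<psi> ` A \<union> \<psi> ` R) (\<psi> ` S \<union> \<psi> ` R)) * prod z (\<psi> ` A - \<psi> ` S) =
        of_bool (unicyclic V (A \<union> R) (S \<union> R)) * prod y (A - S)"
      unfolding image_Un[symmetric] diff using sub by (simp only: uni w)
  qed simp
  have S: "square_sum ?V z (\<psi> ` D) (\<psi> ` {e, f}) = square_sum V y D {e, f}"
    unfolding square_sum_def reindex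
  proof (rule sum.cong)
    fix S assume S: "S \<in> Pow D"
    then have "S \<subseteq> E" using D by auto
    then show "prod z (\<psi> ` S) * (circuit_sum ?V z (\<psi> ` D) (\<psi> ` {e, f}) (\<psi> ` {e, f}) (\<psi> ` S))\<^sup>2 =
        prod y S * (circuit_sum V y D {e, f} {e, f} S)\<^sup>2"
      using S e f by (simp only: w C Pow_iff insert_subset empty_subsetI simp_thms)
  qed simp
  have "pair_identity ?V z (\<psi> ` D) (\<psi> e) (\<psi> f)"
    using assms(1) e f neq inj_onD[OF assms(2) _ e f] unfolding pair_identities_def img[symmetric] by auto
  then show "pair_identity V y (E - {e, f}) e f"
    using F[of "{}"] F[of "{e}"] F[of "{f}"] F[of "{e, f}"] S e f
    unfolding pair_identity_def D_def[symmetric] by simp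
qed

section \<open>Cycle spaces of graphs\<close>

definition incident :: "('v, 'e) mgraph \<Rightarrow> 'e \<Rightarrow> 'v \<Rightarrow> bool" where
  "incident G x v \<longleftrightarrow> card (ends G x) = 2 \<and> v \<in> ends G x"

definition odd_degree :: "('v, 'e) mgraph \<Rightarrow> 'e set \<Rightarrow> 'v \<Rightarrow> bool" where
  "odd_degree G C v \<longleftrightarrow> odd (card {x \<in> C. incident G x v})"

definition cycle_space :: "('v, 'e) mgraph \<Rightarrow> 'e set set" where
  "cycle_space G = {C. C \<subseteq> edges G \<and> (\<forall>v. \<not> odd_degree G C v)}"

lemma odd_card_sym_diff:
  assumes "finite A" "finite B"
  shows "odd (card (sym_diff A B)) \<longleftrightarrow> odd (card A) \<noteq> odd (card B)"
proof -
  have "card A = card (A \<inter> B) + card (A - B)" "card B = card (A \<inter> B) + card (B - A)"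
    using card_Int_Diff[OF assms(1), of B] card_Int_Diff[OF assms(2), of A] by (simp_all add: Int_commute)
  moreover have "card (sym_diff A B) = card (A - B) + card (B - A)"
    using assms by (intro card_Un_disjoint) auto
  ultimately show ?thesis by auto
qed

lemma odd_degree_sym_diff:
  assumes "finite C" "finite D"
  shows "odd_degree G (sym_diff C D) v \<longleftrightarrow> odd_degree G C v \<noteq> odd_degree G D v"
proof -
  have "{x \<in> sym_diff C D. incident G x v} =
      sym_diff {x \<in> C. incident G x v} {x \<in> D. incident G x v}" by auto
  then show ?thesis
    unfolding odd_degree_def using odd_card_sym_diff[of "{x \<in> C. incident G x v}"] assms by simp
qed

lemma odd_degree_empty [simp]: "\<not> odd_degree G {} v"
  unfolding odd_degree_def by simp

lemma odd_degree_remove: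
  assumes "finite C"
  shows "odd_degree G C v \<longleftrightarrow> odd_degree G (C - {x}) v \<noteq> (x \<in> C \<and> incident G x v)"
proof (cases "x \<in> C \<and> incident G x v")
  case True
  then have "{y \<in> C. incident G y v} = insert x {y \<in> C - {x}. incident G y v}" by auto
  then show ?thesis unfolding odd_degree_def using True assms by simp
next
  case False
  then have "{y \<in> C. incident G y v} = {y \<in> C - {x}. incident G y v}" by auto
  then show ?thesis unfolding odd_degree_def using False by simp
qed

lemma odd_degree_insert:
  assumes "finite C" "x \<notin> C"
  shows "odd_degree G (insert x C) v \<longleftrightarrow> odd_degree G C v \<noteq> incident G x v"
  using odd_degree_remove[of "insert x C" G v x] assms by simp

lemma odd_degree_cong:
  "(\<And>x. x \<in> C \<Longrightarrow> incident G x v = incident G' x v') \<Longrightarrow> odd_degree G C v = odd_degree G' C v'"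
  unfolding odd_degree_def by (metis (mono_tags, lifting) Collect_cong)

lemma not_odd_degree: "(\<And>x. x \<in> C \<Longrightarrow> \<not> incident G x v) \<Longrightarrow> \<not> odd_degree G C v"
  using odd_degree_def[of G C v] by (metis (mono_tags, lifting) card.empty empty_Collect_eq even_zero)

lemma cycle_space_subset: "cycle_space G \<subseteq> Pow (edges G)"
  unfolding cycle_space_def by auto

lemma empty_in_cycle_space: "{} \<in> cycle_space G"
  unfolding cycle_space_def by simp

lemma sym_diff_closed_cycle_space:
  assumes "finite (edges G)"
  shows "sym_diff_closed (cycle_space G)"
  unfolding sym_diff_closed_def
proof (intro ballI)
  fix C D assume C: "C \<in> cycle_space G" and D: "D \<in> cycle_space G"
  then have "finite C" "finite D" using assms unfolding cycle_space_def by (auto intro: finite_subset)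
  then show "sym_diff C D \<in> cycle_space G"
    using C D unfolding cycle_space_def by (simp add: odd_degree_sym_diff) blast
qed

lemma even_sum_neq:
  assumes "finite I"
  shows "even (\<Sum>i\<in>I. of_bool (P i \<noteq> Q i) :: nat) \<longleftrightarrow>
    even ((\<Sum>i\<in>I. of_bool (P i)) + (\<Sum>i\<in>I. of_bool (Q i) :: nat))"
  using assms
proof induction
  case (insert x F)
  then show ?case by (cases "P x"; cases "Q x") (simp_all del: sum_of_bool_eq)
qed simp

lemma incident_pair: "ends G x = {p, q} \<Longrightarrow> incident G x v \<longleftrightarrow> (v = p) \<noteq> (v = q)"
  unfolding incident_def by (auto simp: card_insert_if)

lemma sum_cyclic_shift:
  "(\<Sum>i<length xs. f (xs ! (Suc i mod length xs))) = (\<Sum>i<length xs. (f (xs ! i) :: nat))"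
proof -
  have "(\<Sum>i<length xs. f (xs ! (Suc i mod length xs))) = (\<Sum>i<length xs. f (rotate1 xs ! i))"
    by (intro sum.cong) (simp_all add: nth_rotate1)
  also have "\<dots> = sum_list (map f (rotate1 xs))"
    by (simp add: sum_list_sum_nth atLeast0LessThan)
  also have "\<dots> = sum_list (map f xs)" by (cases xs) simp_all
  also have "\<dots> = (\<Sum>i<length xs. f (xs ! i))" by (simp add: sum_list_sum_nth atLeast0LessThan)
  finally show ?thesis .
qed

lemma is_cycle_in_cycle_space:
  assumes "is_cycle G C"
  shows "C \<in> cycle_space G" "C \<noteq> {}"
proof -
  obtain vs es where C: "C \<subseteq> edges G" "es \<noteq> []" "length vs = length es" "distinct es" "set es = C"
    and e: "\<And>i. i < length es \<Longrightarrow> ends G (es ! i) = {vs ! i, vs ! (Suc i mod length es)}"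
    using assms unfolding is_cycle_def by blast
  show "C \<noteq> {}" using C(2,5) by auto
  have "\<not> odd_degree G C v" for v
  proof -
    let ?n = "length es"
    have "card {x \<in> C. incident G x v} = length (filter (\<lambda>x. incident G x v) es)"
      unfolding distinct_length_filter[OF C(4)] C(5) by (rule arg_cong[of _ _ card]) auto
    also have "\<dots> = (\<Sum>i<?n. of_bool (incident G (es ! i) v))"
      by (simp add: length_filter_conv_card Int_def)
    also have "\<dots> = (\<Sum>i<?n. of_bool ((v = vs ! i) \<noteq> (v = vs ! (Suc i mod ?n))))"
      by (intro sum.cong HOL.refl) (simp add: incident_pair[OF e])
    finally have "even (card {x \<in> C. incident G x v}) \<longleftrightarrow>
        even ((\<Sum>i<?n. of_bool (v = vs ! i)) + (\<Sum>i<?n. of_bool (v = vs ! (Suc i mod ?n)) :: nat))"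
      using even_sum_neq[of "{..<?n}" "\<lambda>i. v = vs ! i" "\<lambda>i. v = vs ! (Suc i mod ?n)"] by simp
    then show ?thesis
      using sum_cyclic_shift[of "\<lambda>w. of_bool (v = w)" vs] C(3) unfolding odd_degree_def by simp
  qed
  then show "C \<in> cycle_space G" using C(1) unfolding cycle_space_def by simp
qed

lemma is_cycle_minimal:
  assumes "is_cycle G C" "D \<in> cycle_space G" "D \<subseteq> C" "D \<noteq> {}"
  shows "D = C"
proof -
  obtain vs es where C: "es \<noteq> []" "length vs = length es" "distinct vs" "distinct es" "set es = C"
    and e: "\<And>i. i < length es \<Longrightarrow> ends G (es ! i) = {vs ! i, vs ! (Suc i mod length es)}"
    using assms(1) unfolding is_cycle_def by blast
  let ?n = "length es"
  have n: "?n > 0" using C(1) by simp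
  have step: "es ! (Suc i mod ?n) \<in> D" if i: "i < ?n" "es ! i \<in> D" for i
  proof (rule ccontr)
    define j where "j = Suc i mod ?n"
    assume "es ! (Suc i mod ?n) \<notin> D"
    then have j: "es ! j \<notin> D" "j < ?n" "i \<noteq> j" using i n unfolding j_def by auto
    have v: "incident G (es ! i) (vs ! j)"
      unfolding incident_pair[OF e[OF i(1)]] j_def[symmetric]
      using i(1) j C(2,3) by (simp add: nth_eq_iff_index_eq)
    have eq: "x = es ! i" if x: "x \<in> D" "incident G x (vs ! j)" for x
    proof -
      obtain k where k: "k < ?n" "x = es ! k"
        using x(1) assms(3) unfolding C(5)[symmetric] by (metis in_set_conv_nth subsetD)
      have "k \<noteq> j" using x(1) j(1) k(2) by auto
      then have "vs ! j \<noteq> vs ! k" using k(1) j(2) C(2,3) by (simp add: nth_eq_iff_index_eq)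
      then have "vs ! j = vs ! (Suc k mod ?n)" using x(2) unfolding k(2) incident_pair[OF e[OF k(1)]] by simp
      then have "j = Suc k mod ?n" using j(2) n C(2,3) by (simp add: nth_eq_iff_index_eq)
      then have "Suc k mod ?n = Suc i mod ?n" unfolding j_def by simp
      then have "k = i" using k(1) i(1) unfolding mod_Suc by (simp split: if_splits)
      then show ?thesis using k(2) by simp
    qed
    have "{x \<in> D. incident G x (vs ! j)} = {es ! i}"
    proof (rule set_eqI)
      show "x \<in> {x \<in> D. incident G x (vs ! j)} \<longleftrightarrow> x \<in> {es ! i}" for x
        using i(2) v eq[of x] by auto
    qed
    then have "odd_degree G D (vs ! j)" unfolding odd_degree_def by simp
    then show False using assms(2) unfolding cycle_space_def by simp
  qed
  obtain i where i: "i < ?n" "es ! i \<in> D"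
    using assms(3,4) unfolding C(5)[symmetric] by (metis all_not_in_conv in_set_conv_nth subsetD)
  have all: "es ! ((i + k) mod ?n) \<in> D" for k
  proof (induction k)
    case (Suc k)
    then show ?case using step[of "(i + k) mod ?n"] n by (simp add: mod_Suc_eq)
  qed (use i in simp)
  have "es ! j \<in> D" if "j < ?n" for j
    using all[of "?n - i + j"] i(1) that by simp
  then have "C \<subseteq> D" using C(5) by (auto simp: in_set_conv_nth)
  then show ?thesis using assms(3) by auto
qed

lemma cycle_in_even_set:
  assumes "wf_mgraph G" "D \<in> cycle_space G" "D \<noteq> {}"
  shows "\<exists>C\<subseteq>D. is_cycle G C"
proof (rule ccontr)
  assume none: "\<not> (\<exists>C\<subseteq>D. is_cycle G C)"
  have D: "D \<subseteq> edges G" "\<And>v. \<not> odd_degree G D v" using assms(2) unfolding cycle_space_def by auto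
  have wf: "ends G x \<subseteq> verts G" "card (ends G x) = 1 \<or> card (ends G x) = 2" if "x \<in> D" for x
    using that D(1) assms(1) unfolding wf_mgraph_def by auto
  have nonloop: "card (ends G x) = 2" if x: "x \<in> D" for x
  proof (rule ccontr)
    assume "card (ends G x) \<noteq> 2"
    then obtain v where "ends G x = {v}" using wf(2)[OF x] by (auto simp: card_1_singleton_iff)
    then have "is_cycle G {x}"
      unfolding is_cycle_def using that D(1) by (intro conjI exI[of _ "[v]"] exI[of _ "[x]"]) auto
    then show False using none that by auto
  qed
  define path where "path p \<longleftrightarrow> (case p of (vs, es) \<Rightarrow> es \<noteq> [] \<and> length vs = Suc (length es) \<and>
    distinct vs \<and> set es \<subseteq> D \<and> (\<forall>i<length es. ends G (es ! i) = {vs ! i, vs ! Suc i}))" for p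
  obtain x where x: "x \<in> D" using assms(3) by auto
  obtain p q where "ends G x = {p, q}" "p \<noteq> q" using nonloop[OF x] by (auto simp: card_2_iff)
  then have init: "path ([p, q], [x])" unfolding path_def using x by auto
  have bound: "length (snd r) < Suc (card (verts G))" if "path r" for r
  proof -
    obtain vs es where r: "r = (vs, es)" by (cases r)
    have "vs ! i \<in> verts G" if "i < length vs" for i
    proof (cases i)
      case 0
      have "vs ! 0 \<in> ends G (es ! 0)" "es ! 0 \<in> D" using \<open>path r\<close> unfolding path_def r by auto
      then show ?thesis using wf(1) 0 by auto
    next
      case (Suc j)
      have "vs ! Suc j \<in> ends G (es ! j)" "es ! j \<in> D"
        using \<open>path r\<close> Suc that unfolding path_def r by auto
      then show ?thesis using wf(1) Suc by auto
    qed
    then have "set vs \<subseteq> verts G" by (auto simp: in_set_conv_nth)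
    then have "card (set vs) \<le> card (verts G)"
      using assms(1) unfolding wf_mgraph_def by (intro card_mono) auto
    then show ?thesis using \<open>path r\<close> unfolding path_def r by (auto simp: distinct_card)
  qed
  have "\<exists>r. path r \<and> (\<forall>r'. path r' \<longrightarrow> length (snd r') \<le> length (snd r))"
    by (rule ex_has_greatest_nat[of path, OF init]) (use bound in blast)
  then obtain r where r: "path r" "\<And>r'. path r' \<Longrightarrow> length (snd r') \<le> length (snd r)" by blast
  obtain vs es where r': "r = (vs, es)" by (cases r)
  have p: "es \<noteq> []" "length vs = Suc (length es)" "distinct vs" "set es \<subseteq> D"
    and e: "\<And>i. i < length es \<Longrightarrow> ends G (es ! i) = {vs ! i, vs ! Suc i}"
    using r(1) unfolding r' path_def by auto
  have max: "length es' \<le> length es" if "path (vs', es')" for vs' es'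
    using r(2)[OF that] unfolding r' by simp
  have vs_eq: "vs ! i = vs ! j \<longleftrightarrow> i = j" if "i < length vs" "j < length vs" for i j
    using p(3) that by (simp add: nth_eq_iff_index_eq)
  have inD: "es ! i \<in> D" if "i < length es" for i using that p(4) by auto
  have e0: "es ! 0 \<in> {x \<in> D. incident G x (vs ! 0)}"
    using p(1) e[of 0] inD[of 0] nonloop[OF inD[of 0]] unfolding incident_def by simp
  have "{x \<in> D. incident G x (vs ! 0)} \<noteq> {es ! 0}"
    using D(2)[of "vs ! 0"] unfolding odd_degree_def by auto
  then obtain y where y: "y \<in> D" "incident G y (vs ! 0)" "y \<noteq> es ! 0" using e0 by blast
  from y(2) obtain s t where "ends G y = {s, t}" "s \<noteq> t" "vs ! 0 = s \<or> vs ! 0 = t"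
    unfolding incident_def card_2_iff by auto
  then obtain q where q: "ends G y = {vs ! 0, q}" "q \<noteq> vs ! 0"
    by (metis insert_commute)
  show False
  proof (cases "q \<in> set vs")
    case False
    have "path (q # vs, y # es)"
      unfolding path_def using p y(1) q(1) e False by (auto simp: nth_Cons split: nat.splits)
    then show False using max by fastforce
  next
    case True
    then obtain j where j: "j < length vs" "q = vs ! j" by (auto simp: in_set_conv_nth)
    have "j \<noteq> 0" using q(2) j(2) by metis
    have jl: "j \<le> length es" using j(1) p(2) by simp
    have ends_eq: "i = k" if "i < length es" "k < length es" "es ! i = es ! k" for i k
    proof -
      have "{vs ! i, vs ! Suc i} = {vs ! k, vs ! Suc k}" using e[OF that(1)] e[OF that(2)] that(3) by simp
      then show ?thesis using that p(2) by (auto simp: doubleton_eq_iff vs_eq)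
    qed
    have "distinct es" using ends_eq by (auto simp: distinct_conv_nth)
    have "y \<notin> set es"
    proof
      assume "y \<in> set es"
      then obtain k where k: "k < length es" "y = es ! k" by (auto simp: in_set_conv_nth)
      have "vs ! 0 \<in> {vs ! k, vs ! Suc k}" using q(1) e[OF k(1)] k(2) by auto
      then have "k = 0" using k(1) p(2) by (auto simp: vs_eq)
      then show False using y(3) k(2) by simp
    qed
    let ?vs = "take (Suc j) vs" and ?es = "take j es @ [y]"
    have len: "length ?vs = Suc j" "length ?es = Suc j" using j(1) jl by simp_all
    have "ends G (?es ! i) = {?vs ! i, ?vs ! (Suc i mod length ?es)}" if "i < length ?es" for i
    proof (cases "i = j")
      case True
      then show ?thesis using q(1) j(2) jl len by (simp add: nth_append insert_commute)
    next
      case False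
      then have "i < j" using that len by simp
      then show ?thesis using e[of i] jl len by (simp add: nth_append)
    qed
    moreover have "distinct ?vs" "distinct ?es"
      using p(3) \<open>distinct es\<close> \<open>y \<notin> set es\<close> by (auto dest: in_set_takeD)
    moreover have sub: "set ?es \<subseteq> D" using p(4) y(1) by (auto dest: in_set_takeD)
    ultimately have "is_cycle G (set ?es)"
      unfolding is_cycle_def using D(1) len by (intro conjI exI[of _ ?vs] exI[of _ ?es]) auto
    then show False using none sub by blast
  qed
qed

lemma is_cycle_iff:
  assumes "wf_mgraph G"
  shows "is_cycle G C \<longleftrightarrow>
    C \<in> cycle_space G \<and> C \<noteq> {} \<and> (\<forall>D\<in>cycle_space G. D \<subseteq> C \<longrightarrow> D = {} \<or> D = C)"
proof
  assume C: "is_cycle G C"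
  show "C \<in> cycle_space G \<and> C \<noteq> {} \<and> (\<forall>D\<in>cycle_space G. D \<subseteq> C \<longrightarrow> D = {} \<or> D = C)"
    using is_cycle_in_cycle_space[OF C] is_cycle_minimal[OF C] by blast
next
  assume C: "C \<in> cycle_space G \<and> C \<noteq> {} \<and> (\<forall>D\<in>cycle_space G. D \<subseteq> C \<longrightarrow> D = {} \<or> D = C)"
  then have C1: "C \<in> cycle_space G" and C2: "C \<noteq> {}"
    and C3: "\<And>D. D \<in> cycle_space G \<Longrightarrow> D \<subseteq> C \<Longrightarrow> D = {} \<or> D = C" by simp_all
  obtain C' where C': "C' \<subseteq> C" "is_cycle G C'" using cycle_in_even_set[OF assms C1 C2] by blast
  have "C' = C" using C3[OF is_cycle_in_cycle_space(1)[OF C'(2)] C'(1)] is_cycle_in_cycle_space(2)[OF C'(2)] by simp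
  then show "is_cycle G C" using C'(2) by simp
qed

lemma spanning_forest_iff:
  assumes "wf_mgraph G"
  shows "spanning_forest G X \<longleftrightarrow> X \<subseteq> edges G \<and> indep (cycle_space G) X"
proof -
  have "indep (cycle_space G) X \<longleftrightarrow> \<not> (\<exists>C. is_cycle G C \<and> C \<subseteq> X)"
  proof
    assume X: "indep (cycle_space G) X"
    show "\<not> (\<exists>C. is_cycle G C \<and> C \<subseteq> X)"
      using is_cycle_in_cycle_space indepD[OF X] by blast
  next
    assume X: "\<not> (\<exists>C. is_cycle G C \<and> C \<subseteq> X)"
    show "indep (cycle_space G) X"
    proof (rule indepI)
      fix C assume C: "C \<in> cycle_space G" "C \<subseteq> X"
      then show "C = {}" using cycle_in_even_set[OF assms C(1)] X by blast
    qed
  qed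
  then show ?thesis unfolding spanning_forest_def by simp
qed

lemma unicyclic_cycle_space_iff:
  assumes "wf_mgraph G"
  shows "unicyclic (cycle_space G) Y T \<longleftrightarrow>
    (\<exists>!C. is_cycle G C \<and> C \<subseteq> Y) \<and> T \<subseteq> (THE C. is_cycle G C \<and> C \<subseteq> Y)"
proof
  assume "unicyclic (cycle_space G) Y T"
  then obtain C where C: "C \<in> cycle_space G" "C \<subseteq> Y" "C \<noteq> {}" "T \<subseteq> C"
    and uniq: "\<And>D. D \<in> cycle_space G \<Longrightarrow> D \<subseteq> Y \<Longrightarrow> D = {} \<or> D = C" by (rule unicyclicE) (rule that)
  have cyc: "is_cycle G C" unfolding is_cycle_iff[OF assms] using C(1-3) uniq by (meson subset_trans)
  have eq: "D = C" if "is_cycle G D \<and> D \<subseteq> Y" for D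
    using uniq[of D] is_cycle_in_cycle_space[of G D] that by blast
  have the: "(THE C. is_cycle G C \<and> C \<subseteq> Y) = C"
    by (rule the_equality) (use cyc C(2) in simp, rule eq)
  show "(\<exists>!C. is_cycle G C \<and> C \<subseteq> Y) \<and> T \<subseteq> (THE C. is_cycle G C \<and> C \<subseteq> Y)"
  proof
    show "\<exists>!C. is_cycle G C \<and> C \<subseteq> Y"
      by (rule ex1I[of _ C]) (use cyc C(2) in simp, rule eq)
    show "T \<subseteq> (THE C. is_cycle G C \<and> C \<subseteq> Y)" unfolding the by (rule C(4))
  qed
next
  assume *: "(\<exists>!C. is_cycle G C \<and> C \<subseteq> Y) \<and> T \<subseteq> (THE C. is_cycle G C \<and> C \<subseteq> Y)"
  define C where "C = (THE C. is_cycle G C \<and> C \<subseteq> Y)"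
  have C: "is_cycle G C" "C \<subseteq> Y" using theI'[OF conjunct1[OF *]] unfolding C_def by auto
  have uniq: "D = C" if "is_cycle G D" "D \<subseteq> Y" for D
    unfolding C_def by (rule the1_equality[OF conjunct1[OF *], symmetric]) (use that in simp)
  have fin: "finite (edges G)" using assms unfolding wf_mgraph_def by simp
  have "D = C" if D: "D \<in> cycle_space G" "D \<subseteq> Y" "D \<noteq> {}" for D
  proof -
    have CD: "C \<subseteq> B" if B: "B \<in> cycle_space G" "B \<subseteq> Y" "B \<noteq> {}" for B
    proof -
      obtain C' where "C' \<subseteq> B" "is_cycle G C'" using cycle_in_even_set[OF assms B(1,3)] by blast
      then show ?thesis using uniq[of C'] B(2) by auto
    qed
    have "sym_diff D C \<in> cycle_space G"
      using sym_diff_closed_cycle_space[OF fin] D(1) is_cycle_in_cycle_space(1)[OF C(1)]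
      unfolding sym_diff_closed_def by simp
    moreover have "sym_diff D C = D - C" using CD[OF D] by auto
    ultimately have "D - C \<in> cycle_space G" by simp
    then have "D - C = {}"
      using CD[of "D - C"] D(2) is_cycle_in_cycle_space(2)[OF C(1)] by blast
    then show ?thesis using CD[OF D] by auto
  qed
  then have dich: "D = {} \<or> D = C" if "D \<in> cycle_space G" "D \<subseteq> Y" for D
    using that by blast
  have "T \<subseteq> C" using * unfolding C_def by simp
  then show "unicyclic (cycle_space G) Y T"
    by (rule unicyclicI[OF is_cycle_in_cycle_space(1)[OF C(1)] C(2)
        is_cycle_in_cycle_space(2)[OF C(1)] _ dich])
qed

lemma in_cycle_space_iff:
  "C \<in> cycle_space G \<longleftrightarrow> C \<subseteq> edges G \<and> (\<forall>v. \<not> odd_degree G C v)"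
  unfolding cycle_space_def by simp

lemma finite_subset_edges: "wf_mgraph G \<Longrightarrow> C \<subseteq> edges G \<Longrightarrow> finite C"
  unfolding wf_mgraph_def by (auto intro: finite_subset)

lemma incident_in_verts: "wf_mgraph G \<Longrightarrow> x \<in> edges G \<Longrightarrow> incident G x v \<Longrightarrow> v \<in> verts G"
  unfolding wf_mgraph_def incident_def by auto

lemma wf_delete_edge: "wf_mgraph G \<Longrightarrow> wf_mgraph (delete_edge G x)"
  unfolding wf_mgraph_def delete_edge_def by auto

lemma wf_delete_vertex: "wf_mgraph G \<Longrightarrow> wf_mgraph (delete_vertex G v)"
  unfolding wf_mgraph_def delete_vertex_def by auto

lemma cycle_space_restrict:
  assumes "ends G' = ends G" "edges G' \<subseteq> edges G"
  shows "cycle_space G' = cycle_space G \<inter> Pow (edges G')"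
proof -
  have "incident G' = incident G" unfolding incident_def assms(1) ..
  then have "odd_degree G' = odd_degree G" unfolding odd_degree_def by simp
  then show ?thesis using assms(2) by (intro set_eqI) (simp add: in_cycle_space_iff, blast)
qed

lemma wf_contract_edge:
  assumes "wf_mgraph G" "x \<in> edges G" "ends G x = {u, v}" "u \<noteq> v"
  shows "wf_mgraph (contract_edge G x u v)"
proof -
  define \<rho> where "\<rho> w = (if w = v then u else w)" for w
  have uv: "u \<in> verts G" "v \<in> verts G" using assms unfolding wf_mgraph_def by auto
  have "\<rho> ` ends G y \<subseteq> verts G - {v} \<and> (card (\<rho> ` ends G y) = 1 \<or> card (\<rho> ` ends G y) = 2)"
    if y: "y \<in> edges G" for y
  proof -
    have e: "ends G y \<subseteq> verts G" "card (ends G y) = 1 \<or> card (ends G y) = 2"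
      using y assms(1) unfolding wf_mgraph_def by auto
    have "finite (ends G y)" "ends G y \<noteq> {}" using e(2) by (auto intro: card_ge_0_finite)
    then have "card (\<rho> ` ends G y) \<noteq> 0" "card (\<rho> ` ends G y) \<le> 2"
      using card_image_le[of "ends G y" \<rho>] e(2) by auto
    moreover have "\<rho> ` ends G y \<subseteq> verts G - {v}" using e(1) uv assms(4) unfolding \<rho>_def by auto
    ultimately show ?thesis by auto
  qed
  then show ?thesis using assms(1) unfolding wf_mgraph_def contract_edge_def \<rho>_def by auto
qed

lemma odd_degree_neq:
  assumes "finite C" "\<And>x. x \<in> C \<Longrightarrow> incident G' x w \<longleftrightarrow> incident G x u \<noteq> incident G x v"
  shows "odd_degree G' C w \<longleftrightarrow> odd_degree G C u \<noteq> odd_degree G C v"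
proof -
  have "{x \<in> C. incident G' x w} = sym_diff {x \<in> C. incident G x u} {x \<in> C. incident G x v}"
    using assms(2) by auto
  then show ?thesis unfolding odd_degree_def using assms(1) by (simp add: odd_card_sym_diff)
qed

lemma cycle_space_contract_edge:
  assumes "wf_mgraph G" "x \<in> edges G" "ends G x = {u, v}" "u \<noteq> v"
  shows "cycle_space (contract_edge G x u v) = (\<lambda>C. C - {x}) ` cycle_space G"
proof -
  let ?G = "contract_edge G x u v"
  define \<rho> where "\<rho> w = (if w = v then u else w)" for w
  have ends: "ends ?G y = \<rho> ` ends G y" for y unfolding contract_edge_def \<rho>_def by simp
  have inc: "incident ?G y w \<longleftrightarrow>
      (if w = v then False else if w = u then incident G y u \<noteq> incident G y v else incident G y w)"
    if y: "y \<in> edges G" for y w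
  proof -
    have "card (ends G y) = 1 \<or> card (ends G y) = 2" using y assms(1) unfolding wf_mgraph_def by auto
    then obtain s t where st: "ends G y = {s, t}" by (auto simp: card_1_singleton_iff card_2_iff)
    then have "ends ?G y = {\<rho> s, \<rho> t}" unfolding ends by simp
    then show ?thesis unfolding incident_pair[OF st] incident_pair[OF \<open>ends ?G y = {\<rho> s, \<rho> t}\<close>]
      using assms(4) unfolding \<rho>_def by auto
  qed
  have deg: "odd_degree ?G D w \<longleftrightarrow>
      (if w = v then False else if w = u then odd_degree G D u \<noteq> odd_degree G D v else odd_degree G D w)"
    if D: "D \<subseteq> edges G" for D w
  proof -
    have inc': "incident ?G y w \<longleftrightarrow>
      (if w = v then False else if w = u then incident G y u \<noteq> incident G y v else incident G y w)"
      if "y \<in> D" for y using inc that D by blast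
    consider "w = v" | "w = u" "w \<noteq> v" | "w \<noteq> u" "w \<noteq> v" by blast
    then show ?thesis
    proof cases
      case 1
      then show ?thesis using not_odd_degree[of D ?G w] inc' by simp
    next
      case 2
      then show ?thesis
        using odd_degree_neq[OF finite_subset_edges[OF assms(1) D], of ?G w G u v] inc' by simp
    next
      case 3
      then show ?thesis using odd_degree_cong[of D ?G w G w] inc' by simp
    qed
  qed
  have edges: "edges ?G = edges G - {x}" unfolding contract_edge_def by simp
  have incx: "incident G x w \<longleftrightarrow> w = u \<or> w = v" for w
    unfolding incident_pair[OF assms(3)] using assms(4) by auto
  show ?thesis
  proof (intro set_eqI iffI)
    fix D assume "D \<in> cycle_space ?G"
    then have D: "D \<subseteq> edges G - {x}" "\<And>w. \<not> odd_degree ?G D w"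
      unfolding in_cycle_space_iff edges by auto
    have DG: "D \<subseteq> edges G" using D(1) by auto
    have eq: "odd_degree G D u = odd_degree G D v" using D(2)[of u] deg[OF DG, of u] assms(4) by auto
    have other: "\<not> odd_degree G D w" if "w \<noteq> u" "w \<noteq> v" for w
      using D(2)[of w] deg[OF DG, of w] that by simp
    show "D \<in> (\<lambda>C. C - {x}) ` cycle_space G"
    proof (cases "odd_degree G D u")
      case False
      have "\<not> odd_degree G D w" for w
        using other False eq by metis
      then have "D \<in> cycle_space G" using DG unfolding in_cycle_space_iff by simp
      moreover have "D = D - {x}" using D(1) by auto
      ultimately show ?thesis by (rule rev_image_eqI)
    next
      case True
      have x: "x \<notin> D" using D(1) by auto
      have "\<not> odd_degree G (insert x D) w" for w
        unfolding odd_degree_insert[OF finite_subset_edges[OF assms(1) DG] x] incx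
        using other True eq by metis
      then have "insert x D \<in> cycle_space G" using DG assms(2) unfolding in_cycle_space_iff by simp
      moreover have "D = insert x D - {x}" using x by auto
      ultimately show ?thesis by (rule rev_image_eqI)
    qed
  next
    fix D assume "D \<in> (\<lambda>C. C - {x}) ` cycle_space G"
    then obtain C where CG: "C \<in> cycle_space G" and D: "D = C - {x}" by (rule imageE)
    then have C: "C \<subseteq> edges G" "\<And>w. \<not> odd_degree G C w" unfolding in_cycle_space_iff by auto
    have DG: "D \<subseteq> edges G" using C(1) D by auto
    have d: "odd_degree G D w \<longleftrightarrow> x \<in> C \<and> (w = u \<or> w = v)" for w
      using odd_degree_remove[OF finite_subset_edges[OF assms(1) C(1)], of G w x] C(2)[of w]
      unfolding D incx by metis
    have "\<not> odd_degree ?G D w" for w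
      unfolding deg[OF DG] d by auto
    then show "D \<in> cycle_space ?G" unfolding in_cycle_space_iff edges using C(1) D by auto
  qed
qed

lemma non_loop_notin_cycle_space:
  assumes "ends G x = {u, v}" "u \<noteq> v"
  shows "{x} \<notin> cycle_space G"
proof -
  have "odd_degree G {x} u"
    using odd_degree_insert[of "{}" x G u] assms(2) unfolding incident_pair[OF assms(1)] by simp
  then show ?thesis unfolding in_cycle_space_iff by auto
qed

lemma has_minor_pair_identities:
  assumes "has_minor H M" "wf_mgraph H" "pair_identities (cycle_space H) (edges H) TYPE('r::comm_ring_1)"
    and tf: "\<And>r::'r. r + r = 0 \<Longrightarrow> r = 0"
  shows "wf_mgraph M \<and> pair_identities (cycle_space M) (edges M) TYPE('r)"
  using assms(1)
proof induction
  case refl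
  then show ?case using assms by simp
next
  case (delete_edge M x)
  then have M: "wf_mgraph M" "pair_identities (cycle_space M) (edges M) TYPE('r)" "finite (edges M)"
    by (auto simp: wf_mgraph_def)
  have e: "ends (Defs.delete_edge M x) = ends M" "edges (Defs.delete_edge M x) \<subseteq> edges M"
    unfolding delete_edge_def by auto
  show ?case
    using wf_delete_edge[OF M(1)] pair_identities_restrict[OF M(2,3) e(2)]
    unfolding cycle_space_restrict[OF e] by simp
next
  case (delete_vertex M v)
  then have M: "wf_mgraph M" "pair_identities (cycle_space M) (edges M) TYPE('r)" "finite (edges M)"
    by (auto simp: wf_mgraph_def)
  have e: "ends (Defs.delete_vertex M v) = ends M" "edges (Defs.delete_vertex M v) \<subseteq> edges M"
    unfolding delete_vertex_def by auto
  show ?case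
    using wf_delete_vertex[OF M(1)] pair_identities_restrict[OF M(2,3) e(2)]
    unfolding cycle_space_restrict[OF e] by simp
next
  case (contract_edge M x u v)
  then have M: "wf_mgraph M" "pair_identities (cycle_space M) (edges M) TYPE('r)" "finite (edges M)"
    by (auto simp: wf_mgraph_def)
  have "edges (Defs.contract_edge M x u v) = edges M - {x}" unfolding contract_edge_def by simp
  moreover have "pair_identities ((\<lambda>C. C - {x}) ` cycle_space M) (edges M - {x}) TYPE('r)"
    by (rule pair_identities_contract[OF M(2) tf M(3) sym_diff_closed_cycle_space[OF M(3)]
          contract_edge.hyps(2) non_loop_notin_cycle_space[OF contract_edge.hyps(3,4)]])
  ultimately show ?case
    using wf_contract_edge[OF M(1) contract_edge.hyps(2-4)]
    unfolding cycle_space_contract_edge[OF M(1) contract_edge.hyps(2-4)] by simp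
qed

lemma cycle_space_iso:
  assumes "wf_mgraph G" "wf_mgraph H" "inj_on \<phi> (verts G)" "bij_betw \<psi> (edges G) (edges H)"
    and ends: "\<And>x. x \<in> edges G \<Longrightarrow> ends H (\<psi> x) = \<phi> ` ends G x"
  shows "cycle_space H = image \<psi> ` cycle_space G"
proof -
  have inj: "inj_on \<psi> (edges G)" and img: "\<psi> ` edges G = edges H"
    using assms(4) unfolding bij_betw_def by auto
  have sub: "ends G x \<subseteq> verts G" if "x \<in> edges G" for x
    using that assms(1) unfolding wf_mgraph_def by auto
  have inc: "incident H (\<psi> x) (\<phi> v) \<longleftrightarrow> incident G x v" if "x \<in> edges G" "v \<in> verts G" for x v
    unfolding incident_def ends[OF that(1)] card_image[OF inj_on_subset[OF assms(3) sub[OF that(1)]]]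
      inj_on_image_mem_iff[OF assms(3) that(2) sub[OF that(1)]] ..
  have out: "\<not> incident H (\<psi> x) w" if "x \<in> edges G" "w \<notin> \<phi> ` verts G" for x w
    unfolding incident_def ends[OF that(1)] using that(2) sub[OF that(1)] by auto
  have odd: "odd_degree H (\<psi> ` C) (\<phi> v) \<longleftrightarrow> odd_degree G C v" if "C \<subseteq> edges G" "v \<in> verts G" for C v
  proof -
    have "{y \<in> \<psi> ` C. incident H y (\<phi> v)} = \<psi> ` {x \<in> C. incident G x v}"
      using inc[OF _ that(2)] that(1) by auto
    moreover have "inj_on \<psi> {x \<in> C. incident G x v}" using inj by (rule inj_on_subset) (use that in auto)
    ultimately show ?thesis unfolding odd_degree_def by (simp add: card_image)
  qed
  have mem: "\<psi> ` C \<in> cycle_space H \<longleftrightarrow> C \<in> cycle_space G" if C: "C \<subseteq> edges G" for C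
  proof -
    have "(\<forall>w. \<not> odd_degree H (\<psi> ` C) w) \<longleftrightarrow> (\<forall>v. \<not> odd_degree G C v)"
    proof (intro iffI allI)
      fix v assume H: "\<forall>w. \<not> odd_degree H (\<psi> ` C) w"
      show "\<not> odd_degree G C v"
      proof (cases "v \<in> verts G")
        case True
        then show ?thesis using H odd[OF C] by blast
      next
        case False
        then show ?thesis using incident_in_verts[OF assms(1)] C by (intro not_odd_degree) blast
      qed
    next
      fix w assume G: "\<forall>v. \<not> odd_degree G C v"
      show "\<not> odd_degree H (\<psi> ` C) w"
      proof (cases "w \<in> \<phi> ` verts G")
        case True
        then show ?thesis using G odd[OF C] by blast
      next
        case False
        then show ?thesis using out C by (intro not_odd_degree) blast
      qed
    qed
    moreover have "\<psi> ` C \<subseteq> edges H" using C img by auto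
    ultimately show ?thesis using C unfolding in_cycle_space_iff by simp
  qed
  show ?thesis
  proof (intro set_eqI iffI)
    fix D assume D: "D \<in> cycle_space H"
    then obtain C where "C \<subseteq> edges G" "D = \<psi> ` C"
      using subset_imageE[of D \<psi> "edges G"] unfolding img in_cycle_space_iff by blast
    then show "D \<in> image \<psi> ` cycle_space G" using D mem by auto
  next
    fix D assume "D \<in> image \<psi> ` cycle_space G"
    then show "D \<in> cycle_space H" using mem cycle_space_subset[of G] by auto
  qed
qed

lemma two_sum_cycle_space:
  assumes wf: "wf_mgraph H" and g: "g \<in> edges H" "card (ends H g) = 2"
    and K: "edges K = {g, a, b}" "a \<notin> edges H" "b \<notin> edges H" "a \<noteq> b"
    and M: "edges M = insert a (insert b (edges H - {g}))"
    and inj: "inj_on \<phi> (verts H)"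
    and endsM: "\<And>x. x \<in> edges H - {g} \<Longrightarrow> ends M x = \<phi> ` ends H x"
    and C: "C \<subseteq> edges M"
    and ab: "\<And>z. ((a \<in> C \<and> incident M a z) \<noteq> (b \<in> C \<and> incident M b z)) \<longleftrightarrow> t \<and> z \<in> \<phi> ` ends H g"
  shows "C \<in> cycle_space M \<longleftrightarrow> (C - {a, b}) \<union> (if t then {g} else {}) \<in> cycle_space H"
proof -
  define D where "D = C - {a, b}"
  have D: "D \<subseteq> edges H - {g}" using C M unfolding D_def by auto
  have finD: "finite D" using finite_subset_edges[OF wf, of D] D by auto
  then have finC: "finite C" unfolding D_def by auto
  have sub: "ends H x \<subseteq> verts H" if "x \<in> edges H" for x
    using that wf unfolding wf_mgraph_def by auto
  have inc: "incident M x (\<phi> v) \<longleftrightarrow> incident H x v" if "x \<in> D" "v \<in> verts H" for x v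
  proof -
    have x: "x \<in> edges H" "x \<in> edges H - {g}" using that D by auto
    show ?thesis
      unfolding incident_def endsM[OF x(2)] card_image[OF inj_on_subset[OF inj sub[OF x(1)]]]
        inj_on_image_mem_iff[OF inj that(2) sub[OF x(1)]] ..
  qed
  have out: "\<not> incident M x z" if "x \<in> D" "z \<notin> \<phi> ` verts H" for x z
  proof -
    have x: "x \<in> edges H" "x \<in> edges H - {g}" using that D by auto
    show ?thesis unfolding incident_def endsM[OF x(2)] using that(2) sub[OF x(1)] by auto
  qed
  have degM: "odd_degree M C z \<longleftrightarrow> odd_degree M D z \<noteq> (t \<and> z \<in> \<phi> ` ends H g)" for z
  proof -
    have "odd_degree M C z \<longleftrightarrow> odd_degree M (C - {a} - {b}) z \<noteq>
        ((a \<in> C \<and> incident M a z) \<noteq> (b \<in> C \<and> incident M b z))"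
      using odd_degree_remove[OF finC, of M z a] odd_degree_remove[of "C - {a}" M z b] finC K(4) by auto
    moreover have "C - {a} - {b} = D" unfolding D_def by auto
    ultimately show ?thesis unfolding ab by simp
  qed
  let ?C = "D \<union> (if t then {g} else {})"
  have degH: "odd_degree H ?C v \<longleftrightarrow> odd_degree H D v \<noteq> (t \<and> v \<in> ends H g)" for v
  proof (cases t)
    case True
    have "g \<notin> D" using D by auto
    then have "odd_degree H (insert g D) v \<longleftrightarrow> odd_degree H D v \<noteq> incident H g v"
      by (rule odd_degree_insert[OF finD])
    then show ?thesis using True g(2) unfolding incident_def by simp
  qed simp
  have eq: "odd_degree M C (\<phi> v) \<longleftrightarrow> odd_degree H ?C v" if v: "v \<in> verts H" for v
    unfolding degM degH inj_on_image_mem_iff[OF inj v sub[OF g(1)]]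
    using odd_degree_cong[of D M "\<phi> v" H v] inc v by simp
  have "(\<forall>z. \<not> odd_degree M C z) \<longleftrightarrow> (\<forall>v. \<not> odd_degree H ?C v)"
  proof (intro iffI allI)
    fix v assume M: "\<forall>z. \<not> odd_degree M C z"
    show "\<not> odd_degree H ?C v"
    proof (cases "v \<in> verts H")
      case True
      then show ?thesis using M eq by blast
    next
      case False
      have "?C \<subseteq> edges H" using D g(1) by auto
      then show ?thesis using incident_in_verts[OF wf] False by (intro not_odd_degree) blast
    qed
  next
    fix z assume H: "\<forall>v. \<not> odd_degree H ?C v"
    show "\<not> odd_degree M C z"
    proof (cases "z \<in> \<phi> ` verts H")
      case True
      then show ?thesis using H eq by blast
    next
      case False
      then have "z \<notin> \<phi> ` ends H g" using sub[OF g(1)] by auto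
      moreover have "\<not> odd_degree M D z" using out False by (intro not_odd_degree)
      ultimately show ?thesis unfolding degM by simp
    qed
  qed
  moreover have "?C \<subseteq> edges H" using D g(1) by auto
  ultimately show ?thesis using C unfolding in_cycle_space_iff D_def[symmetric] by simp
qed

lemma is_two_sumE:
  assumes "is_two_sum H K g M"
  obtains \<phi> \<psi> where "edges H \<inter> edges K = {g}" "edges M = (edges H \<union> edges K) - {g}"
    "inj_on \<phi> (verts H)" "inj_on \<psi> (verts K)" "verts M = \<phi> ` verts H \<union> \<psi> ` verts K"
    "\<phi> ` verts H \<inter> \<psi> ` verts K = \<phi> ` ends H g" "\<phi> ` ends H g = \<psi> ` ends K g"
    "\<And>x. x \<in> edges H - {g} \<Longrightarrow> ends M x = \<phi> ` ends H x"
    "\<And>x. x \<in> edges K - {g} \<Longrightarrow> ends M x = \<psi> ` ends K x"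
proof -
  show thesis
    using assms unfolding is_two_sum_def
    by (elim conjE exE, intro that) (assumption | erule bspec)+
qed

lemma wf_two_sum:
  assumes "wf_mgraph H" "wf_mgraph K" "is_two_sum H K g M"
  shows "wf_mgraph M"
proof -
  from assms(3) obtain \<phi> \<psi> where M: "edges M = (edges H \<union> edges K) - {g}" "inj_on \<phi> (verts H)" "inj_on \<psi> (verts K)"
      "verts M = \<phi> ` verts H \<union> \<psi> ` verts K"
      "\<And>x. x \<in> edges H - {g} \<Longrightarrow> ends M x = \<phi> ` ends H x"
      "\<And>x. x \<in> edges K - {g} \<Longrightarrow> ends M x = \<psi> ` ends K x"
    by (rule is_two_sumE) (rule that)
  have "ends M x \<subseteq> verts M \<and> (card (ends M x) = 1 \<or> card (ends M x) = 2)" if x: "x \<in> edges M" for x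
  proof (cases "x \<in> edges H")
    case True
    then have e: "ends H x \<subseteq> verts H" "card (ends H x) = 1 \<or> card (ends H x) = 2"
      using assms(1) unfolding wf_mgraph_def by auto
    have "x \<in> edges H - {g}" using x True M(1) by auto
    note eq = M(5)[OF this]
    show ?thesis
      unfolding eq M(4) card_image[OF inj_on_subset[OF M(2) e(1)]] using e by auto
  next
    case False
    then have x': "x \<in> edges K - {g}" using x M(1) by auto
    then have e: "ends K x \<subseteq> verts K" "card (ends K x) = 1 \<or> card (ends K x) = 2"
      using assms(2) unfolding wf_mgraph_def by auto
    show ?thesis
      unfolding M(6)[OF x'] M(4) card_image[OF inj_on_subset[OF M(3) e(1)]] using e by auto
  qed
  moreover have "finite (verts M)" "finite (edges M)"
    using assms(1,2) M(1,4) unfolding wf_mgraph_def by auto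
  ultimately show ?thesis unfolding wf_mgraph_def by simp
qed

lemma is_K3E:
  assumes "is_K3 K" "g \<in> edges K"
  obtains a b p q w where "distinct [g, a, b]" "distinct [p, q, w]" "edges K = {g, a, b}"
    "verts K = {p, q, w}" "ends K g = {p, q}" "ends K a = {p, w}" "ends K b = {w, q}"
proof -
  obtain u v w a b c where d: "distinct [u, v, w]" "distinct [a, b, c]"
    and K: "verts K = {u, v, w}" "edges K = {a, b, c}"
    "ends K a = {u, v}" "ends K b = {v, w}" "ends K c = {w, u}"
    using assms(1) unfolding is_K3_def by blast
  have n: "v \<noteq> u" "w \<noteq> u" "w \<noteq> v" "b \<noteq> a" "c \<noteq> a" "c \<noteq> b" using d by auto
  consider "g = a" | "g = b" | "g = c" using assms(2) K(2) by auto
  then show thesis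
  proof cases
    case 1
    then show thesis using that[of b c v u w] d K n by (simp add: insert_commute)
  next
    case 2
    then show thesis using that[of c a w v u] d K n by (simp add: insert_commute)
  next
    case 3
    then show thesis using that[of a b u w v] d K n by (simp add: insert_commute)
  qed
qed

lemma wf_K3: "is_K3 K \<Longrightarrow> wf_mgraph K"
  unfolding is_K3_def wf_mgraph_def by (elim exE conjE) (simp add: card_insert_if)

lemma wf_K3_dual: "is_K3_dual K \<Longrightarrow> wf_mgraph K"
  unfolding is_K3_dual_def wf_mgraph_def by (elim exE conjE) (simp add: card_insert_if)

lemma is_K3_dualE:
  assumes "is_K3_dual K" "g \<in> edges K"
  obtains a b p q where "distinct [g, a, b]" "p \<noteq> q" "edges K = {g, a, b}" "verts K = {p, q}"
    "\<And>x. x \<in> edges K \<Longrightarrow> ends K x = {p, q}"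
proof -
  obtain u v a b c where d: "u \<noteq> v" "distinct [a, b, c]"
    and K: "verts K = {u, v}" "edges K = {a, b, c}"
    "ends K a = {u, v}" "ends K b = {u, v}" "ends K c = {u, v}"
    using assms(1) unfolding is_K3_dual_def by (elim exE conjE) (rule that)
  have e: "ends K x = {u, v}" if "x \<in> edges K" for x
    using that unfolding K(2) by (elim insertE) (simp_all add: K(3-5))
  consider "g = a" | "g = b" | "g = c" using assms(2) K(2) by auto
  then show thesis
  proof cases
    case 1
    then show thesis by (intro that[of b c u v] e) (use d K(1,2) in auto)
  next
    case 2
    then show thesis by (intro that[of a c u v] e) (use d K(1,2) in auto)
  next
    case 3
    then show thesis by (intro that[of a b u v] e) (use d K(1,2) in auto)
  qed
qed

lemma extension_cycle_space:
  assumes "wf_mgraph H" "g \<in> edges H" "a \<notin> edges H" "b \<notin> edges H" "a \<noteq> b"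
  shows "extension (cycle_space H) (edges H) g a b"
  using assms sym_diff_closed_cycle_space[of H] cycle_space_subset[of H] empty_in_cycle_space[of H]
  unfolding extension_def wf_mgraph_def by simp

lemma series_extension:
  assumes "wf_mgraph H" "is_K3 K" "is_two_sum H K g M"
  obtains a b where "extension (cycle_space H) (edges H) g a b"
    "edges M = insert a (insert b (edges H - {g}))"
    "cycle_space M = series_space (cycle_space H) (edges H) g a b"
proof -
  from assms(3) obtain \<phi> \<psi> where M: "edges H \<inter> edges K = {g}" "edges M = (edges H \<union> edges K) - {g}"
      "inj_on \<phi> (verts H)" "inj_on \<psi> (verts K)"
      "\<phi> ` verts H \<inter> \<psi> ` verts K = \<phi> ` ends H g" "\<phi> ` ends H g = \<psi> ` ends K g"
      "\<And>x. x \<in> edges H - {g} \<Longrightarrow> ends M x = \<phi> ` ends H x"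
      "\<And>x. x \<in> edges K - {g} \<Longrightarrow> ends M x = \<psi> ` ends K x"
    by (rule is_two_sumE) (rule that)
  have g: "g \<in> edges H" "g \<in> edges K" using M(1) by auto
  obtain a b p q w where d: "distinct [g, a, b]" "distinct [p, q, w]"
    and K: "edges K = {g, a, b}" "verts K = {p, q, w}"
      "ends K g = {p, q}" "ends K a = {p, w}" "ends K b = {w, q}"
    using is_K3E[OF assms(2) g(2)] by metis
  have a: "a \<notin> edges H" "b \<notin> edges H" "a \<noteq> b" using M(1) K(1) d(1) by auto
  have E: "edges M = insert a (insert b (edges H - {g}))" using M(2) K(1) d(1) a by auto
  have psi: "\<psi> p \<noteq> \<psi> q" "\<psi> p \<noteq> \<psi> w" "\<psi> q \<noteq> \<psi> w"
    using M(4) d(2) unfolding K(2) inj_on_def by auto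
  have eg: "\<phi> ` ends H g = {\<psi> p, \<psi> q}" using M(6) K(3) by simp
  have w: "\<psi> w \<notin> \<phi> ` verts H"
  proof
    assume "\<psi> w \<in> \<phi> ` verts H"
    then have "\<psi> w \<in> \<phi> ` ends H g" unfolding M(5)[symmetric] K(2) by simp
    then show False using psi unfolding eg by simp
  qed
  have ea: "ends M a = {\<psi> p, \<psi> w}" using M(8)[of a] K(1,4) d(1) by auto
  have eb: "ends M b = {\<psi> w, \<psi> q}" using M(8)[of b] K(1,5) d(1) by auto
  have sub: "ends H x \<subseteq> verts H" if "x \<in> edges H" for x
    using that assms(1) unfolding wf_mgraph_def by auto
  have "card (\<phi> ` ends H g) = 2" unfolding eg using psi(1) by simp
  then have card: "card (ends H g) = 2" using card_image[OF inj_on_subset[OF M(3) sub[OF g(1)]]] by simp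
  have both: "a \<in> C \<longleftrightarrow> b \<in> C" if C: "C \<in> cycle_space M" for C
  proof -
    have CM: "C \<subseteq> edges M" "\<not> odd_degree M C (\<psi> w)" using C unfolding in_cycle_space_iff by auto
    have fin: "finite C"
      using CM(1) assms(1) unfolding E wf_mgraph_def by (auto intro: finite_subset)
    have "\<not> odd_degree M (C - {a} - {b}) (\<psi> w)"
    proof (rule not_odd_degree)
      fix x assume "x \<in> C - {a} - {b}"
      then have x: "x \<in> edges H - {g}" "x \<in> edges H" using CM(1) unfolding E by auto
      show "\<not> incident M x (\<psi> w)"
        unfolding incident_def M(7)[OF x(1)] using w sub[OF x(2)] by auto
    qed
    moreover have "incident M a (\<psi> w)" "incident M b (\<psi> w)"
      unfolding incident_pair[OF ea] incident_pair[OF eb] using psi by auto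
    ultimately show ?thesis
      using odd_degree_remove[OF fin, of M "\<psi> w" a] odd_degree_remove[of "C - {a}" M "\<psi> w" b]
        fin CM(2) a(3) by auto
  qed
  have iff: "C \<in> cycle_space M \<longleftrightarrow> (C - {a, b}) \<union> (if a \<in> C then {g} else {}) \<in> cycle_space H"
    if C: "C \<subseteq> edges M" "a \<in> C \<longleftrightarrow> b \<in> C" for C
  proof (rule two_sum_cycle_space[OF assms(1) g(1) card K(1) a E M(3) M(7) C(1)])
    show "((a \<in> C \<and> incident M a z) \<noteq> (b \<in> C \<and> incident M b z)) \<longleftrightarrow> a \<in> C \<and> z \<in> \<phi> ` ends H g" for z
      unfolding incident_pair[OF ea] incident_pair[OF eb] eg C(2) using psi by auto
  qed
  have "C \<in> cycle_space M \<longleftrightarrow> C \<in> series_space (cycle_space H) (edges H) g a b" for C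
  proof (cases "C \<subseteq> edges M \<and> (a \<in> C \<longleftrightarrow> b \<in> C)")
    case True
    then show ?thesis using iff[of C] unfolding series_space_def E[symmetric] by simp
  next
    case False
    then show ?thesis
      using both[of C] cycle_space_subset[of M] unfolding series_space_def E[symmetric] by blast
  qed
  then have "cycle_space M = series_space (cycle_space H) (edges H) g a b" by (rule set_eqI)
  then show thesis using that extension_cycle_space[OF assms(1) g(1) a] E by simp
qed

lemma parallel_extension:
  assumes "wf_mgraph H" "is_K3_dual K" "is_two_sum H K g M"
  obtains a b where "extension (cycle_space H) (edges H) g a b"
    "edges M = insert a (insert b (edges H - {g}))"
    "cycle_space M = parallel_space (cycle_space H) (edges H) g a b"
proof -
  from assms(3) obtain \<phi> \<psi> where M: "edges H \<inter> edges K = {g}" "edges M = (edges H \<union> edges K) - {g}"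
      "inj_on \<phi> (verts H)" "inj_on \<psi> (verts K)" "\<phi> ` ends H g = \<psi> ` ends K g"
      "\<And>x. x \<in> edges H - {g} \<Longrightarrow> ends M x = \<phi> ` ends H x"
      "\<And>x. x \<in> edges K - {g} \<Longrightarrow> ends M x = \<psi> ` ends K x"
    by (rule is_two_sumE) (rule that)
  have g: "g \<in> edges H" "g \<in> edges K" using M(1) by auto
  obtain a b p q where d: "distinct [g, a, b]" "p \<noteq> q"
    and K: "edges K = {g, a, b}" "verts K = {p, q}" "\<And>x. x \<in> edges K \<Longrightarrow> ends K x = {p, q}"
    using is_K3_dualE[OF assms(2) g(2)] by metis
  have a: "a \<notin> edges H" "b \<notin> edges H" "a \<noteq> b" using M(1) K(1) d(1) by auto
  have E: "edges M = insert a (insert b (edges H - {g}))" using M(2) K(1) d(1) a by auto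
  have psi: "\<psi> p \<noteq> \<psi> q" using M(4) d(2) unfolding K(2) inj_on_def by auto
  have eg: "\<phi> ` ends H g = {\<psi> p, \<psi> q}" using M(5) K(3)[OF g(2)] by simp
  have ea: "ends M a = {\<psi> p, \<psi> q}" using M(7)[of a] K(3)[of a] K(1) d(1) by auto
  have eb: "ends M b = {\<psi> p, \<psi> q}" using M(7)[of b] K(3)[of b] K(1) d(1) by auto
  have sub: "ends H g \<subseteq> verts H"
    using g(1) assms(1) unfolding wf_mgraph_def by auto
  have "card (\<phi> ` ends H g) = 2" unfolding eg using psi(1) by simp
  then have card: "card (ends H g) = 2" using card_image[OF inj_on_subset[OF M(3) sub]] by simp
  have iff: "C \<in> cycle_space M \<longleftrightarrow>
      (C - {a, b}) \<union> (if (a \<in> C) \<noteq> (b \<in> C) then {g} else {}) \<in> cycle_space H"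
    if C: "C \<subseteq> edges M" for C
  proof (rule two_sum_cycle_space[OF assms(1) g(1) card K(1) a E M(3) M(6) C(1)])
    show "((a \<in> C \<and> incident M a z) \<noteq> (b \<in> C \<and> incident M b z)) \<longleftrightarrow>
        (a \<in> C) \<noteq> (b \<in> C) \<and> z \<in> \<phi> ` ends H g" for z
      unfolding incident_pair[OF ea] incident_pair[OF eb] eg using psi by auto
  qed
  have "C \<in> cycle_space M \<longleftrightarrow> C \<in> parallel_space (cycle_space H) (edges H) g a b" for C
  proof (cases "C \<subseteq> edges M")
    case True
    have "(if (a \<in> C) \<noteq> (b \<in> C) then {g} else {}) = (if a \<in> C \<longleftrightarrow> b \<in> C then {} else {g})" by simp
    then show ?thesis using iff[OF True] True unfolding parallel_space_def E[symmetric] by simp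
  next
    case False
    then show ?thesis
      using cycle_space_subset[of M] unfolding parallel_space_def E[symmetric] by blast
  qed
  then have "cycle_space M = parallel_space (cycle_space H) (edges H) g a b" by (rule set_eqI)
  then show thesis using that extension_cycle_space[OF assms(1) g(1) a] E by simp
qed

section \<open>Series-parallel graphs\<close>

lemma edge_identities_coloop: "edge_identities {{}} {x} TYPE('r::comm_ring_1)"
  unfolding edge_identities_def edge_identity_def square_sum_def circuit_sum_def unicyclic_def
  by simp

lemma pair_identities_coloop: "pair_identities V {x} TYPE('r::comm_ring_1)"
  unfolding pair_identities_def by simp

lemma extension_coloop: "distinct [x, g, c] \<Longrightarrow> extension {{}} {x} x g c"
  unfolding extension_def sym_diff_closed_def by auto

definition digon :: "'a \<Rightarrow> 'a \<Rightarrow> 'a set set" where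
  "digon g c = {C. C \<subseteq> {g, c} \<and> (g \<in> C \<longleftrightarrow> c \<in> C)}"

lemma parallel_space_coloop:
  assumes "distinct [x, g, c]"
  shows "parallel_space {{}} {x} x g c = digon g c"
proof -
  have "C - {g, c} \<union> (if g \<in> C \<longleftrightarrow> c \<in> C then {} else {x}) \<in> {{}} \<longleftrightarrow> (g \<in> C \<longleftrightarrow> c \<in> C)"
    if "C \<subseteq> {g, c}" for C using that by auto
  then show ?thesis unfolding parallel_space_def digon_def by auto
qed

lemma digon_identities:
  assumes "infinite (UNIV :: 'a set)" "g \<noteq> c"
  shows "pair_identities (digon g c) {g, c :: 'a} TYPE('r::comm_ring_1)"
    and "edge_identities (digon g c) {g, c} TYPE('r)"
proof -
  obtain x where "x \<notin> {g, c}" using ex_new_if_finite[OF assms(1), of "{g, c}"] by auto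
  then have x: "distinct [x, g, c]" using assms(2) by auto
  have E: "insert g (insert c ({x} - {x})) = {g, c}" by simp
  show "pair_identities (digon g c) {g, c} TYPE('r)"
    using extension.pair_identities_par[OF extension_coloop[OF x] pair_identities_coloop]
    unfolding parallel_space_coloop[OF x] E .
  show "edge_identities (digon g c) {g, c} TYPE('r)"
    using extension.edge_identities_par[OF extension_coloop[OF x] edge_identities_coloop]
    unfolding parallel_space_coloop[OF x] E .
qed

lemma extension_digon:
  assumes "distinct [g, c, a, b]"
  shows "extension (digon g c) {g, c} g a b"
proof -
  have "sym_diff C D \<in> digon g c" if "C \<in> digon g c" "D \<in> digon g c" for C D
    using that unfolding digon_def by auto
  moreover have "{} \<in> digon g c" "digon g c \<subseteq> Pow {g, c}" unfolding digon_def by auto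
  ultimately show ?thesis using assms unfolding extension_def sym_diff_closed_def by auto
qed

lemma series_space_digon:
  assumes "distinct [g, c, a, b]"
  shows "series_space (digon g c) {g, c} g a b =
    {C. C \<subseteq> {a, b, c} \<and> (a \<in> C \<longleftrightarrow> b \<in> C) \<and> (a \<in> C \<longleftrightarrow> c \<in> C)}"
proof -
  have E: "insert a (insert b ({g, c} - {g})) = {a, b, c}" using assms by auto
  have mem: "C - {a, b} \<union> (if a \<in> C then {g} else {}) \<in> digon g c \<longleftrightarrow> (a \<in> C \<longleftrightarrow> c \<in> C)"
    if "C \<subseteq> {a, b, c}" for C
  proof -
    have mem: "C - {a, b} \<union> (if a \<in> C then {g} else {}) \<subseteq> {g, c}"
        "g \<in> C - {a, b} \<union> (if a \<in> C then {g} else {}) \<longleftrightarrow> a \<in> C"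
        "c \<in> C - {a, b} \<union> (if a \<in> C then {g} else {}) \<longleftrightarrow> c \<in> C"
      using that assms by auto
    then show ?thesis unfolding digon_def mem_Collect_eq by simp
  qed
  show ?thesis unfolding series_space_def E by (intro Collect_cong conj_cong HOL.refl mem)
qed

lemma parallel_space_digon:
  assumes "distinct [g, c, a, b]"
  shows "parallel_space (digon g c) {g, c} g a b =
    {C. C \<subseteq> {a, b, c} \<and> ((a \<in> C) \<noteq> (b \<in> C) \<longleftrightarrow> c \<in> C)}"
proof -
  have E: "insert a (insert b ({g, c} - {g})) = {a, b, c}" using assms by auto
  have mem: "C - {a, b} \<union> (if a \<in> C \<longleftrightarrow> b \<in> C then {} else {g}) \<in> digon g c \<longleftrightarrow>
      ((a \<in> C) \<noteq> (b \<in> C) \<longleftrightarrow> c \<in> C)"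
    if "C \<subseteq> {a, b, c}" for C
  proof -
    have mem: "C - {a, b} \<union> (if a \<in> C \<longleftrightarrow> b \<in> C then {} else {g}) \<subseteq> {g, c}"
        "g \<in> C - {a, b} \<union> (if a \<in> C \<longleftrightarrow> b \<in> C then {} else {g}) \<longleftrightarrow> (a \<in> C) \<noteq> (b \<in> C)"
        "c \<in> C - {a, b} \<union> (if a \<in> C \<longleftrightarrow> b \<in> C then {} else {g}) \<longleftrightarrow> c \<in> C"
      using that assms by auto
    then show ?thesis unfolding digon_def mem_Collect_eq by simp
  qed
  show ?thesis unfolding parallel_space_def E by (intro Collect_cong conj_cong HOL.refl mem)
qed

lemma odd_degree_three:
  assumes "distinct [a, b, c]" "C \<subseteq> {a, b, c}"
  shows "odd_degree G C v \<longleftrightarrow>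
    (a \<in> C \<and> incident G a v) \<noteq> ((b \<in> C \<and> incident G b v) \<noteq> (c \<in> C \<and> incident G c v))"
proof -
  have fin: "finite C" using assms(2) by (rule finite_subset) simp
  have empty: "C - {a} - {b} - {c} = {}" using assms(2) by auto
  have "\<not> odd_degree G (C - {a} - {b} - {c}) v" unfolding empty by simp
  then have "odd_degree G (C - {a} - {b}) v \<longleftrightarrow> c \<in> C \<and> incident G c v"
    using odd_degree_remove[of "C - {a} - {b}" G v c] fin assms(1) by auto
  then show ?thesis
    using odd_degree_remove[OF fin, of G v a] odd_degree_remove[of "C - {a}" G v b] fin assms(1)
    by auto
qed

lemma K3_identities:
  assumes "infinite (UNIV :: 'e set)" "is_K3 (K :: ('v, 'e) mgraph)" and tf: "\<And>r::'r. r + r = 0 \<Longrightarrow> r = 0"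
  shows "pair_identities (cycle_space K) (edges K) TYPE('r::comm_ring_1)"
    and "edge_identities (cycle_space K) (edges K) TYPE('r)"
proof -
  obtain u v w a b c where d: "distinct [u, v, w]" "distinct [a, b, c]"
    and K: "verts K = {u, v, w}" "edges K = {a, b, c}"
    "ends K a = {u, v}" "ends K b = {v, w}" "ends K c = {w, u}"
    using assms(2) unfolding is_K3_def by blast
  obtain g where "g \<notin> {a, b, c}" using ex_new_if_finite[OF assms(1), of "{a, b, c}"] by auto
  then have g: "distinct [g, c, a, b]" "g \<noteq> c" using d(2) by auto
  have "cycle_space K = series_space (digon g c) {g, c} g a b"
  proof (rule set_eqI)
    fix C
    have "(\<forall>z. \<not> odd_degree K C z) \<longleftrightarrow> (a \<in> C \<longleftrightarrow> b \<in> C) \<and> (a \<in> C \<longleftrightarrow> c \<in> C)"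
      if "C \<subseteq> {a, b, c}"
    proof -
      have deg: "odd_degree K C z \<longleftrightarrow> (a \<in> C \<and> (z = u) \<noteq> (z = v)) \<noteq>
          ((b \<in> C \<and> (z = v) \<noteq> (z = w)) \<noteq> (c \<in> C \<and> (z = w) \<noteq> (z = u)))" for z
        unfolding odd_degree_three[OF d(2) that] incident_pair[OF K(3)] incident_pair[OF K(4)]
          incident_pair[OF K(5)] ..
      show ?thesis
      proof
        assume "\<forall>z. \<not> odd_degree K C z"
        then have "\<not> odd_degree K C u" "\<not> odd_degree K C v" by auto
        then show "(a \<in> C \<longleftrightarrow> b \<in> C) \<and> (a \<in> C \<longleftrightarrow> c \<in> C)" unfolding deg using d(1) by auto
      qed (auto simp: deg)
    qed
    then show "C \<in> cycle_space K \<longleftrightarrow> C \<in> series_space (digon g c) {g, c} g a b"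
      unfolding in_cycle_space_iff series_space_digon[OF g(1)] K(2) mem_Collect_eq by blast
  qed
  moreover have "edges K = insert a (insert b ({g, c} - {g}))" using K(2) g by auto
  ultimately show "pair_identities (cycle_space K) (edges K) TYPE('r)"
      "edge_identities (cycle_space K) (edges K) TYPE('r)"
    using extension.pair_identities_ser[OF extension_digon[OF g(1)] digon_identities[OF assms(1) g(2)] tf]
      extension.edge_identities_ser[OF extension_digon[OF g(1)] digon_identities(2)[OF assms(1) g(2)] tf]
    by simp_all
qed

lemma K3_dual_identities:
  assumes "infinite (UNIV :: 'e set)" "is_K3_dual (K :: ('v, 'e) mgraph)"
  shows "pair_identities (cycle_space K) (edges K) TYPE('r::comm_ring_1)"
    and "edge_identities (cycle_space K) (edges K) TYPE('r)"
proof -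
  obtain u v a b c where d: "u \<noteq> v" "distinct [a, b, c]"
    and K: "verts K = {u, v}" "edges K = {a, b, c}"
    "ends K a = {u, v}" "ends K b = {u, v}" "ends K c = {u, v}"
    using assms(2) unfolding is_K3_dual_def by (elim exE conjE) (rule that)
  obtain g where "g \<notin> {a, b, c}" using ex_new_if_finite[OF assms(1), of "{a, b, c}"] by auto
  then have g: "distinct [g, c, a, b]" "g \<noteq> c" using d(2) by auto
  have "cycle_space K = parallel_space (digon g c) {g, c} g a b"
  proof (rule set_eqI)
    fix C
    have "(\<forall>z. \<not> odd_degree K C z) \<longleftrightarrow> ((a \<in> C) \<noteq> (b \<in> C) \<longleftrightarrow> c \<in> C)"
      if "C \<subseteq> {a, b, c}"
    proof -
      have deg: "odd_degree K C z \<longleftrightarrow> (a \<in> C \<and> (z = u) \<noteq> (z = v)) \<noteq>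
          ((b \<in> C \<and> (z = u) \<noteq> (z = v)) \<noteq> (c \<in> C \<and> (z = u) \<noteq> (z = v)))" for z
        unfolding odd_degree_three[OF d(2) that] incident_pair[OF K(3)] incident_pair[OF K(4)]
          incident_pair[OF K(5)] ..
      show ?thesis
      proof
        assume "\<forall>z. \<not> odd_degree K C z"
        then have "\<not> odd_degree K C u" by auto
        then show "((a \<in> C) \<noteq> (b \<in> C) \<longleftrightarrow> c \<in> C)" unfolding deg using d(1) by auto
      qed (auto simp: deg)
    qed
    then show "C \<in> cycle_space K \<longleftrightarrow> C \<in> parallel_space (digon g c) {g, c} g a b"
      unfolding in_cycle_space_iff parallel_space_digon[OF g(1)] K(2) mem_Collect_eq by blast
  qed
  moreover have "edges K = insert a (insert b ({g, c} - {g}))" using K(2) g by auto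
  ultimately show "pair_identities (cycle_space K) (edges K) TYPE('r)"
      "edge_identities (cycle_space K) (edges K) TYPE('r)"
    using extension.pair_identities_par[OF extension_digon[OF g(1)] digon_identities(1)[OF assms(1) g(2)]]
      extension.edge_identities_par[OF extension_digon[OF g(1)] digon_identities(2)[OF assms(1) g(2)]]
    by simp_all
qed

lemma sp_generated_identities:
  fixes G :: "('v, 'e) mgraph"
  assumes "sp_generated G" "infinite (UNIV :: 'e set)" and tf: "\<And>r::'r. r + r = 0 \<Longrightarrow> r = 0"
  shows "wf_mgraph G \<and> pair_identities (cycle_space G) (edges G) TYPE('r::comm_ring_1) \<and>
    edge_identities (cycle_space G) (edges G) TYPE('r)"
  using assms(1)
proof induction
  case (K3 G)
  show ?case using wf_K3[OF K3] K3_identities[OF assms(2) K3 tf] by simp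
next
  case (K3_dual G)
  show ?case using wf_K3_dual[OF K3_dual] K3_dual_identities[OF assms(2) K3_dual] by simp
next
  case (series G g K M)
  then have G: "wf_mgraph G" "pair_identities (cycle_space G) (edges G) TYPE('r)"
    "edge_identities (cycle_space G) (edges G) TYPE('r)" by simp_all
  obtain a b where ext: "extension (cycle_space G) (edges G) g a b"
    and M: "edges M = insert a (insert b (edges G - {g}))"
      "cycle_space M = series_space (cycle_space G) (edges G) g a b"
    using series_extension[OF G(1) series.hyps(3,4)] .
  show ?case
    unfolding M
    using wf_two_sum[OF G(1) wf_K3[OF series.hyps(3)] series.hyps(4)]
      extension.pair_identities_ser[OF ext G(2,3) tf] extension.edge_identities_ser[OF ext G(3) tf]
    by simp
next
  case (parallel G g K M)
  then have G: "wf_mgraph G" "pair_identities (cycle_space G) (edges G) TYPE('r)"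
    "edge_identities (cycle_space G) (edges G) TYPE('r)" by simp_all
  obtain a b where ext: "extension (cycle_space G) (edges G) g a b"
    and M: "edges M = insert a (insert b (edges G - {g}))"
      "cycle_space M = parallel_space (cycle_space G) (edges G) g a b"
    using parallel_extension[OF G(1) parallel.hyps(3,4)] .
  show ?case
    unfolding M
    using wf_two_sum[OF G(1) wf_K3_dual[OF parallel.hyps(3)] parallel.hyps(4)]
      extension.pair_identities_par[OF ext G(2)] extension.edge_identities_par[OF ext G(3)]
    by simp
qed

lemma series_parallel_pair_identities:
  fixes G :: "('v, 'e) mgraph"
  assumes "wf_mgraph G" "series_parallel G" and tf: "\<And>r::'r. r + r = 0 \<Longrightarrow> r = 0"
  shows "pair_identities (cycle_space G) (edges G) TYPE('r::comm_ring_1)"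
proof -
  obtain H M :: "(nat, nat) mgraph" where HM: "sp_generated H" "has_minor H M" "mgraph_iso G M"
    using assms(2) unfolding series_parallel_def by blast
  have "wf_mgraph H \<and> pair_identities (cycle_space H) (edges H) TYPE('r)"
    using sp_generated_identities[OF HM(1) infinite_UNIV_nat tf] by simp
  then have M: "wf_mgraph M" "pair_identities (cycle_space M) (edges M) TYPE('r)"
    using has_minor_pair_identities[OF HM(2) _ _ tf] by simp_all
  obtain \<phi> \<psi> where iso: "bij_betw \<phi> (verts G) (verts M)" "bij_betw \<psi> (edges G) (edges M)"
    "\<And>x. x \<in> edges G \<Longrightarrow> ends M (\<psi> x) = \<phi> ` ends G x"
    using HM(3) unfolding mgraph_iso_def by blast
  have "cycle_space M = image \<psi> ` cycle_space G" "edges M = \<psi> ` edges G" "inj_on \<psi> (edges G)"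
    using cycle_space_iso[OF assms(1) M(1) _ iso(2,3)] iso(1,2) unfolding bij_betw_def by simp_all
  then show ?thesis
    using pair_identities_image[of \<psi> "cycle_space G" "edges G"] M(2) cycle_space_subset by metis
qed

lemma partial_deriv_add: "partial_deriv x (p + q) = partial_deriv x p + partial_deriv x q"
  by (intro poly_mapping_eqI) (simp add: lookup_partial_deriv lookup_add algebra_simps)

lemma partial_deriv_zero: "partial_deriv x 0 = 0"
  unfolding partial_deriv_def by simp

lemma partial_deriv_sum: "partial_deriv x (\<Sum>i\<in>I. p i) = (\<Sum>i\<in>I. partial_deriv x (p i))"
  by (induction I rule: infinite_finite_induct) (simp_all add: partial_deriv_zero partial_deriv_add)

lemma monomial_of_eq_single:
  assumes "finite X"
  shows "monomial_of X = Poly_Mapping.single (\<Sum>x\<in>X. Poly_Mapping.single x 1) 1"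
  unfolding monomial_of_def
  using assms by induction (simp_all add: indet_def mult_single)

lemma partial_deriv_monomial_of:
  assumes "finite X"
  shows "partial_deriv x (monomial_of X) = of_bool (x \<in> X) * monomial_of (X - {x})"
proof -
  let ?m = "\<Sum>z\<in>X. Poly_Mapping.single z (1::nat)"
  have look: "Poly_Mapping.lookup ?m x = (if x \<in> X then 1 else 0)"
    using assms by (simp add: lookup_sum lookup_single when_def)
  have "partial_deriv x (monomial_of X) =
      Poly_Mapping.single (?m - Poly_Mapping.single x 1) (int (Poly_Mapping.lookup ?m x))"
    unfolding monomial_of_eq_single[OF assms] partial_deriv_def by simp
  also have "\<dots> = of_bool (x \<in> X) * monomial_of (X - {x})"
  proof (cases "x \<in> X")
    case True
    have "?m = Poly_Mapping.single x 1 + (\<Sum>z\<in>X - {x}. Poly_Mapping.single z 1)"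
      using assms True by (rule sum.remove)
    then show ?thesis using True assms look by (simp add: monomial_of_eq_single)
  next
    case False
    then show ?thesis unfolding look by simp
  qed
  finally show ?thesis .
qed

lemma mpoly_add_self_eq_0:
  fixes p :: "'e mpoly"
  assumes "p + p = 0"
  shows "p = 0"
proof (rule poly_mapping_eqI)
  fix m
  have "Poly_Mapping.lookup p m + Poly_Mapping.lookup p m = 0"
    using assms by (metis lookup_add lookup_zero)
  then show "Poly_Mapping.lookup p m = Poly_Mapping.lookup 0 m" by simp
qed

lemma sum_filter_of_bool:
  fixes h :: "'a \<Rightarrow> 'r::comm_ring_1"
  assumes "finite A"
  shows "(\<Sum>x\<in>{x \<in> A. P x}. h x) = (\<Sum>x\<in>A. of_bool (P x) * h x)"
  unfolding sum.inter_filter[OF assms] by (intro sum.cong) simp_all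

lemma forest_poly_eq:
  assumes "wf_mgraph G"
  shows "forest_poly G = forest_sum (cycle_space G) indet (edges G) {}"
proof -
  have fin: "finite (edges G)" using assms unfolding wf_mgraph_def by simp
  have eq: "{X. spanning_forest G X} = {X \<in> Pow (edges G). indep (cycle_space G) (X \<union> {})}"
    unfolding spanning_forest_iff[OF assms] by auto
  show ?thesis
    unfolding forest_poly_def forest_sum_def eq monomial_of_def
    by (rule sum_filter_of_bool) (use fin in simp)
qed

lemma partial_deriv_forest_sum:
  assumes "finite D" "x \<in> D"
  shows "partial_deriv x (forest_sum V indet D R) = forest_sum V indet (D - {x}) (insert x R)"
proof -
  have D: "D = insert x (D - {x})" "finite (D - {x})" "x \<notin> D - {x}" using assms by auto
  have b: "partial_deriv x (of_bool P * p) = of_bool P * partial_deriv x p" for P p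
    by (cases P) (simp_all add: partial_deriv_zero)
  have "partial_deriv x (of_bool (indep V (X \<union> R)) * prod indet X) +
      partial_deriv x (of_bool (indep V (insert x X \<union> R)) * prod indet (insert x X)) =
      of_bool (indep V (X \<union> insert x R)) * prod indet X" if "X \<in> Pow (D - {x})" for X
  proof -
    have "finite X" "x \<notin> X" using that D(2) by (auto intro: finite_subset)
    then show ?thesis
      unfolding b monomial_of_def[symmetric] by (simp add: partial_deriv_monomial_of)
  qed
  then show ?thesis
    unfolding forest_sum_def partial_deriv_sum
    by (subst D(1)) (simp only: sum_Pow_insert[OF D(2,3)] cong: sum.cong)
qed

theorem theorem1p2:
  fixes G :: "('v, 'e) mgraph" and e f :: 'e
  assumes "wf_mgraph G" and "series_parallel G"
    and "e \<in> edges G" and "f \<in> edges G" and "e \<noteq> f"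
  shows "\<exists>c :: 'e set \<Rightarrow> 'e set \<Rightarrow> int.
    (\<forall>S C. c S C \<in> {1, -1}) \<and>
    Delta (forest_poly G) e f =
      (\<Sum>S\<in>S_sets G e f. monomial_of S *
        (\<Sum>A\<in>A_sets G e f S. of_int (c S (cycle_of G e f A)) * monomial_of (A - S))\<^sup>2)"
proof -
  define D where "D = edges G - {e, f}"
  define V where "V = cycle_space G"
  have fin: "finite (edges G)" "finite D"
    using assms(1) unfolding wf_mgraph_def D_def by auto
  have E: "edges G = insert e (insert f D)" "e \<notin> insert f D" "f \<notin> insert e D" "e \<notin> D" "f \<notin> D"
    unfolding D_def using assms(3-5) by auto
  have Ef: "edges G - {f} = insert e D" "edges G - {e} = insert f D" "insert e D - {e} = D"
    using E by auto
  define Z where "Z R = forest_sum V indet D R" for R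
  have G: "forest_poly G = Z {} + indet f * Z {f} + indet e * (Z {e} + indet f * Z {e, f})"
    unfolding forest_poly_eq[OF assms(1)] E(1) V_def[symmetric] Z_def
    using fin(2) E(2-5) by (simp add: forest_sum_insert insert_commute[of f e])
  have Ge: "partial_deriv e (forest_poly G) = Z {e} + indet f * Z {e, f}"
    unfolding forest_poly_eq[OF assms(1)] V_def[symmetric] Z_def
      partial_deriv_forest_sum[OF fin(1) assms(3)] Ef
    using fin(2) E(2-5) by (simp add: forest_sum_insert insert_commute[of f e])
  have Gf: "partial_deriv f (forest_poly G) = Z {f} + indet e * Z {e, f}"
    unfolding forest_poly_eq[OF assms(1)] V_def[symmetric] Z_def
      partial_deriv_forest_sum[OF fin(1) assms(4)] Ef
    using fin(2) E(2-5) by (simp add: forest_sum_insert insert_commute[of f e])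
  have Gef: "partial_deriv e (partial_deriv f (forest_poly G)) = Z {e, f}"
    unfolding forest_poly_eq[OF assms(1)] V_def[symmetric] Z_def
      partial_deriv_forest_sum[OF fin(1) assms(4)] Ef
    using fin(2) E(4) partial_deriv_forest_sum[of "insert e D" e V "{f}"] by simp
  have "pair_identities V (edges G) TYPE('e mpoly)"
    unfolding V_def
    by (rule series_parallel_pair_identities[OF assms(1,2)]) (rule mpoly_add_self_eq_0)
  then have "pair_identity V indet D e f"
    using assms(3-5) unfolding pair_identities_def D_def by blast
  then have "Delta (forest_poly G) e f = square_sum V indet D {e, f}"
    unfolding Delta_def Gef
    unfolding Ge Gf unfolding G pair_identity_def Z_def[symmetric]
    by (simp add: algebra_simps)
  also have "\<dots> = (\<Sum>S\<in>S_sets G e f. monomial_of S * (\<Sum>A\<in>A_sets G e f S. monomial_of (A - S))\<^sup>2)"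
  proof -
    have A: "A_sets G e f S = {A \<in> Pow D. unicyclic V (A \<union> {e, f}) (S \<union> {e, f})}" for S
    proof (rule set_eqI)
      fix A
      have forest: "spanning_forest G A" if "A \<subseteq> D" "unicyclic V (A \<union> {e, f}) (S \<union> {e, f})"
      proof -
        have "unicyclic V (insert e (insert f A)) (S \<union> {e, f})" using that(2) by simp
        then have "indep V (insert f A)"
          by (rule unicyclic_indep) (use that(1) E(4) assms(5) in auto)
        then have "indep V A" by (rule indep_subset) auto
        then show ?thesis
          using that(1) unfolding spanning_forest_iff[OF assms(1)] V_def D_def by auto
      qed
      have "A \<in> A_sets G e f S \<longleftrightarrow>
          A \<subseteq> D \<and> spanning_forest G A \<and> unicyclic V (A \<union> {e, f}) (S \<union> {e, f})"
        unfolding A_sets_def cycle_of_def V_def unicyclic_cycle_space_iff[OF assms(1)] D_def by simp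
      then show "A \<in> A_sets G e f S \<longleftrightarrow> A \<in> {A \<in> Pow D. unicyclic V (A \<union> {e, f}) (S \<union> {e, f})}"
        using forest by auto
    qed
    have C: "circuit_sum V indet D {e, f} {e, f} S = (\<Sum>A\<in>A_sets G e f S. monomial_of (A - S))" for S
      unfolding A circuit_sum_def monomial_of_def
      by (rule sum_filter_of_bool[symmetric]) (use fin(2) in simp)
    have sub: "S_sets G e f \<subseteq> Pow D" unfolding S_sets_def D_def by auto
    have empty: "A_sets G e f S = {}" if S: "S \<in> Pow D - S_sets G e f" for S
    proof (rule ccontr)
      assume "A_sets G e f S \<noteq> {}"
      then obtain A where "A \<in> A_sets G e f S" by auto
      then have A: "\<exists>!C. is_cycle G C \<and> C \<subseteq> A \<union> {e, f}" "S \<union> {e, f} \<subseteq> cycle_of G e f A"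
        unfolding A_sets_def mem_Collect_eq by - (elim conjE, assumption)+
      have "is_cycle G (cycle_of G e f A)"
        using theI'[OF A(1)] unfolding cycle_of_def by (rule conjunct1)
      then have "\<exists>C. is_cycle G C \<and> S \<union> {e, f} \<subseteq> C" using A(2) by blast
      then have "S \<in> S_sets G e f" using S unfolding S_sets_def D_def by simp
      then show False using S by simp
    qed
    show ?thesis
      unfolding square_sum_def C monomial_of_def[symmetric]
      by (rule sum.mono_neutral_right) (use fin(2) sub empty in auto)
  qed
  finally show ?thesis by (intro exI[of _ "\<lambda>_ _. 1"]) simp
qed

end
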